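(* Let $n,p$ be positive integers such that $n$ and $n+p$ are relatively prime. For any continuous function $f\in C([-1,1]^2)$, we have $$\|f-\mathcal{L}_{n,p}f\|_\infty\le\big(C_\Lambda\ln^2(n+p)+1\big)\,E_{n,p}(f).$$ If $\frac{\partial^r f}{\partial x^r},\frac{\partial^s f}{\partial y^s}\in C([-1,1]^2)$ for given $r,s\in\mathbb{N}_0$, we further have the estimate $$\|f-\mathcal{L}_{n,p}f\|_\infty\le C\ln^2(n+p)\left(\frac{\omega\left(\frac{\partial^r f}{\partial x^r};\frac1{n+p},0\right)}{(n+p)^r}+\frac{\omega\left(\frac{\partial^s f}{\partial y^s};0,\frac1n\right)}{n^s}\right)$$ with a constant $C$ independent of $n$ and $p$.
   Context: For positive integers $n,p$ with $n$ and $n+p$ relatively prime, let $\gamma_{n,p}(t) = (\cos(nt),\cos((n+p)t))$ and $\mathrm{LD}_{n,p} := \{\gamma_{n,p}(\frac{\pi k}{n(n+p)}): k=0,\ldots,n(n+p)\}\subset[-1,1]^2$. With $T_i(x)=\cos(i\arccos x)$ and $\Gamma_{n,p}^L := \{(i,j)\in\mathbb{N}_0^2: \frac{i}{n+p}+\frac jn<1\}\cup\{(0,n)\}$, put $\Pi_{n,p}^{2,L} := \mathrm{span}\{T_i(x)T_j(y): (i,j)\in\Gamma_{n,p}^L\}$. For $f\in C([-1,1]^2)$ there is a unique $\mathcal{L}_{n,p}f\in\Pi_{n,p}^{2,L}$ with $\mathcal{L}_{n,p}f(\mathcal{A})=f(\mathcal{A})$ for all $\mathcal{A}\in\mathrm{LD}_{n,p}$.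 The Lebesgue constant $\Lambda_{n,p}$ is the operator norm of $\mathcal{L}_{n,p}$ on $(C([-1,1]^2),\|\cdot\|_\infty)$, where $\|\cdot\|_\infty$ is the maximum norm on $[-1,1]^2$. It is known that $\Lambda_{n,p}\le C_\Lambda\ln^2(n+p)$ with a constant $C_\Lambda$ that does not depend on $n$ and $p$; this is the constant $C_\Lambda$ in the claim. Best approximation: $E_{n,p}(f) := \min_{P\in\Pi_{n,p}^{2,L}}\|f-P\|_\infty$. Modulus of continuity, for $u,v\ge0$: $\omega(f;u,v) := \sup\{|f(x_1,y_1)-f(x_2,y_2)|: x_1,x_2,y_1,y_2\in[-1,1],\ |x_1-x_2|\le u,\ |y_1-y_2|\le v\}$. The zeroth derivative of $f$ is $f$ itself.
   Formalization: The second estimate is proved under the added condition r/(n+p) + s/n < 1; without it the claim is false, e.g. for n = p = r = s = 1 and f(x,y) = xy, where the right side is 0 but f is not reproduced. *)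

theory Defs
  imports "HOL-Analysis.Analysis"
begin

abbreviation I11 :: "real set" where
  "I11 \<equiv> {-1..1}"

abbreviation square :: "(real \<times> real) set" where
  "square \<equiv> I11 \<times> I11"

(* Functions on the square are represented by total functions on real * real;
   C([-1,1]^2) is the set of those that are continuous_on square; values outside
   the square play no role. *)

definition sup_norm :: "(real \<times> real \<Rightarrow> real) \<Rightarrow> real" where
  "sup_norm f = (SUP z\<in>square. \<bar>f z\<bar>)"

definition lissajous :: "nat \<Rightarrow> nat \<Rightarrow> real \<Rightarrow> real \<times> real" where
  "lissajous n p t = (cos (real n * t), cos (real (n + p) * t))"

definition LD :: "nat \<Rightarrow> nat \<Rightarrow> (real \<times> real) set" where
  "LD n p = (\<lambda>k. lissajous n p (pi * real k / real (n * (n + p)))) ` {0..n * (n + p)}"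

definition cheb_T :: "nat \<Rightarrow> real \<Rightarrow> real" where
  "cheb_T i x = cos (real i * arccos x)"

definition Gamma_L :: "nat \<Rightarrow> nat \<Rightarrow> (nat \<times> nat) set" where
  "Gamma_L n p = {(i, j). real i / real (n + p) + real j / real n < 1} \<union> {(0, n)}"

(* The linear span; for n > 0 the index set Gamma_L n p is finite. *)
definition Pi_L :: "nat \<Rightarrow> nat \<Rightarrow> (real \<times> real \<Rightarrow> real) set" where
  "Pi_L n p = {P. \<exists>c :: nat \<times> nat \<Rightarrow> real.
     P = (\<lambda>(x, y). \<Sum>(i, j)\<in>Gamma_L n p. c (i, j) * (cheb_T i x * cheb_T j y))}"

definition interp :: "nat \<Rightarrow> nat \<Rightarrow> (real \<times> real \<Rightarrow> real) \<Rightarrow> real \<times> real \<Rightarrow> real" where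
  "interp n p f = (THE P. P \<in> Pi_L n p \<and> (\<forall>A\<in>LD n p. P A = f A))"

(* Operator norm of the interpolation operator on C([-1,1]^2). The supremum is finite,
   since the interpolant depends linearly on the values at finitely many nodes. *)
definition lebesgue_const :: "nat \<Rightarrow> nat \<Rightarrow> real" where
  "lebesgue_const n p =
     (SUP f\<in>{f. continuous_on square f \<and> sup_norm f \<le> 1}. sup_norm (interp n p f))"

(* The infimum is attained because the space is finite-dimensional. *)
definition best_approx :: "nat \<Rightarrow> nat \<Rightarrow> (real \<times> real \<Rightarrow> real) \<Rightarrow> real" where
  "best_approx n p f = (INF P\<in>Pi_L n p. sup_norm (\<lambda>z. f z - P z))"

definition modulus :: "(real \<times> real \<Rightarrow> real) \<Rightarrow> real \<Rightarrow> real \<Rightarrow> real" where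
  "modulus f u v = Sup {\<bar>f (x1, y1) - f (x2, y2)\<bar> | x1 y1 x2 y2.
     x1 \<in> I11 \<and> x2 \<in> I11 \<and> y1 \<in> I11 \<and> y2 \<in> I11 \<and> \<bar>x1 - x2\<bar> \<le> u \<and> \<bar>y1 - y2\<bar> \<le> v}"

(* has_partial_x r f g: on the square, the r-th partial derivative of f in x exists and equals g.
   Derivatives at the boundary of the square are one-sided. *)
primrec has_partial_x ::
  "nat \<Rightarrow> (real \<times> real \<Rightarrow> real) \<Rightarrow> (real \<times> real \<Rightarrow> real) \<Rightarrow> bool" where
  "has_partial_x 0 f g \<longleftrightarrow> (\<forall>z\<in>square. g z = f z)"
| "has_partial_x (Suc r) f g \<longleftrightarrow> (\<exists>h. has_partial_x r f h \<and>
     (\<forall>x\<in>I11. \<forall>y\<in>I11. ((\<lambda>t. h (t, y)) has_real_derivative g (x, y)) (at x within I11)))"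

primrec has_partial_y ::
  "nat \<Rightarrow> (real \<times> real \<Rightarrow> real) \<Rightarrow> (real \<times> real \<Rightarrow> real) \<Rightarrow> bool" where
  "has_partial_y 0 f g \<longleftrightarrow> (\<forall>z\<in>square. g z = f z)"
| "has_partial_y (Suc s) f g \<longleftrightarrow> (\<exists>h. has_partial_y s f h \<and>
     (\<forall>x\<in>I11. \<forall>y\<in>I11. ((\<lambda>t. h (x, t)) has_real_derivative g (x, y)) (at y within I11)))"

(* The derivative estimate is stated for those n, p with r/(n+p) + s/n < 1, the usual
   restriction in Jackson-type estimates that the degree be large enough for the smoothness.
   It cannot be dropped. For f(x,y) = x^r * y^s both moduli on the right-hand side vanish,
   so the estimate forces f to lie in the span, i.e. (r,s) to lie in Gamma_L n p. In the one
   remaining case, (r,s) = (0,n) with n > 0, take f(x,y) = x * y^n: its distance to the span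
   is bounded below uniformly in p, while the right-hand side tends to 0 as p grows. *)

end

theory Submission
  imports Defs
begin

text \<open>A basis function \<open>T\<^sub>i(x) T\<^sub>j(y)\<close> restricted to the Lissajous curve is a sum of two cosines of
  frequencies \<open>i n \<plusminus> j (n + p)\<close>. By coprimality the sum frequency belongs to no other index in
  \<open>Gamma_L\<close>, so discrete orthogonality on \<open>2 n (n + p)\<close> parameter values makes interpolation injective;
  it is surjective because on the nodes the full tensor basis folds onto \<open>Gamma_L\<close>. Since the
  interpolation operator is then a linear projection, the usual Lebesgue argument bounds the error by
  best approximation.

  For the rate, a de la Vallee-Poussin type operator in each variable, discretized at Chebyshev nodes, reproduces
  low degrees and is uniformly bounded, so \<open>f - V\<^sub>x V\<^sub>y f = (f - V\<^sub>x f) + V\<^sub>x (f - V\<^sub>y f)\<close>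
  needs only pure partial derivatives. Univariate best approximation is controlled by
  Jackson's theorem: a positive Fejer-Korovkin operator for continuous functions, then induction
  on the number of derivatives by subtracting an antiderivative of an approximant of the derivative.\<close>

section \<open>Chebyshev polynomials\<close>

text \<open>What shapes the rate estimate is that the index set is a triangle, while products of
  one-variable approximants fill a rectangle. Degrees \<open>I\<close> in x and \<open>J\<close> in
  y fit only if \<open>I/(n+p) + J/n < 1\<close>. Yet Jackson's theorem with \<open>r\<close>
  derivatives needs \<open>I\<close> to exceed \<open>r\<close> by a margin proportional to
  \<open>n+p\<close>, and likewise \<open>J\<close>, \<open>s\<close> and \<open>n\<close>. Under
  \<open>r/(n+p) + s/n < 1\<close> the gap to 1 is bounded below uniformly: outside finitely many
  pairs \<open>(n, n+p)\<close> it is visibly large, and on those pairs it is positive. A fixed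
  fraction of the gap is spent as extra degree in each variable, so all constants depend on
  \<open>r\<close> and \<open>s\<close> only. The approximation operators have to be linear and
  based on samples. Best approximants of single slices need not assemble into a polynomial in both
  variables, whereas samples at fixed points give sums of products of polynomials. The price is
  twice the extra degree (\<open>r + 2 * d\<close> to reproduce degree \<open>r + d\<close>), which
  keeps the operator norms bounded independently of \<open>d\<close>.\<close>

lemma cheb_T_0 [simp]: "cheb_T 0 x = 1"
  by (simp add: cheb_T_def)

lemma cheb_T_1: "x \<in> I11 \<Longrightarrow> cheb_T (Suc 0) x = x"
  by (simp add: cheb_T_def)

lemma cos_Suc_Suc_mult:
  "cos (real (Suc (Suc i)) * t) = 2 * cos t * cos (real (Suc i) * t) - cos (real i * t)"
proof -
  have "cos (real (Suc i) * t + t) + cos (real (Suc i) * t - t) = 2 * cos t * cos (real (Suc i) * t)"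
    by (simp add: cos_add cos_diff)
  moreover have "real (Suc i) * t + t = real (Suc (Suc i)) * t" "real (Suc i) * t - t = real i * t"
    by (simp_all add: algebra_simps)
  ultimately show ?thesis by simp
qed

lemma cheb_T_Suc_Suc:
  "x \<in> I11 \<Longrightarrow> cheb_T (Suc (Suc i)) x = 2 * x * cheb_T (Suc i) x - cheb_T i x"
  using cos_Suc_Suc_mult[of i "arccos x"] by (simp add: cheb_T_def)

lemma cheb_T_cos: "cheb_T i (cos t) = cos (real i * t)"
proof (induction i rule: induct_nat_012)
  case (ge2 i)
  then show ?case
    using cheb_T_Suc_Suc[of "cos t" i] cos_Suc_Suc_mult[of i t] by simp
qed (simp_all add: cheb_T_1)

lemma abs_cheb_T_le_1: "\<bar>cheb_T i x\<bar> \<le> 1"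
  by (simp add: cheb_T_def)

lemma continuous_on_cheb_T: "continuous_on I11 (cheb_T i)"
  unfolding cheb_T_def by (intro continuous_intros continuous_on_arccos) auto

text \<open>Agreement is required on \<open>I11\<close> only, because \<open>cheb_T\<close>, defined
  through \<open>arccos\<close>, is a polynomial there and uncontrolled elsewhere.\<close>

definition polys :: "nat \<Rightarrow> (real \<Rightarrow> real) set" where
  "polys N = {u. \<exists>c. \<forall>x\<in>I11. u x = (\<Sum>j\<le>N. c j * x ^ j)}"

lemma polysI: "(\<And>x. x \<in> I11 \<Longrightarrow> u x = (\<Sum>j\<le>N. c j * x ^ j)) \<Longrightarrow> u \<in> polys N"
  by (auto simp: polys_def)

lemma polys_mono:
  assumes "M \<le> N" "u \<in> polys M" shows "u \<in> polys N"
proof -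
  obtain c where c: "\<And>x. x \<in> I11 \<Longrightarrow> u x = (\<Sum>j\<le>M. c j * x ^ j)"
    using assms(2) by (auto simp: polys_def)
  have "u x = (\<Sum>j\<le>N. (if j \<le> M then c j else 0) * x ^ j)" if "x \<in> I11" for x
  proof -
    have "(\<Sum>j\<le>N. (if j \<le> M then c j else 0) * x ^ j) = (\<Sum>j\<le>M. c j * x ^ j)"
      using assms(1) by (intro sum.mono_neutral_cong_right) auto
    with c[OF that] show ?thesis by simp
  qed
  then show ?thesis by (rule polysI)
qed

lemma polys_cong:
  assumes "u \<in> polys N" "\<And>x. x \<in> I11 \<Longrightarrow> v x = u x" shows "v \<in> polys N"
  using assms by (auto simp: polys_def)

lemma polys_add:
  assumes "u \<in> polys N" "v \<in> polys N" shows "(\<lambda>x. u x + v x) \<in> polys N"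
proof -
  obtain c where c: "\<And>x. x \<in> I11 \<Longrightarrow> u x = (\<Sum>j\<le>N. c j * x ^ j)"
    using assms by (auto simp: polys_def)
  obtain d where d: "\<And>x. x \<in> I11 \<Longrightarrow> v x = (\<Sum>j\<le>N. d j * x ^ j)"
    using assms by (auto simp: polys_def)
  have "u x + v x = (\<Sum>j\<le>N. (c j + d j) * x ^ j)" if "x \<in> I11" for x
    using c[OF that] d[OF that] by (simp add: algebra_simps sum.distrib)
  then show ?thesis by (rule polysI)
qed

lemma polys_cmult:
  assumes "u \<in> polys N" shows "(\<lambda>x. a * u x) \<in> polys N"
proof -
  obtain c where c: "\<And>x. x \<in> I11 \<Longrightarrow> u x = (\<Sum>j\<le>N. c j * x ^ j)"
    using assms by (auto simp: polys_def)
  have "a * u x = (\<Sum>j\<le>N. (a * c j) * x ^ j)" if "x \<in> I11" for x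
    using c[OF that] by (simp add: sum_distrib_left mult.assoc)
  then show ?thesis by (rule polysI)
qed

lemma polys_const: "(\<lambda>x. a) \<in> polys N"
proof (rule polysI)
  fix x :: real
  show "a = (\<Sum>j\<le>N. (if j = 0 then a else 0) * x ^ j)"
    by (simp add: sum.atMost_shift)
qed

lemma polys_sum:
  "(\<And>k. k \<in> A \<Longrightarrow> u k \<in> polys N) \<Longrightarrow> (\<lambda>x. \<Sum>k\<in>A. u k x) \<in> polys N"
proof (induction A rule: infinite_finite_induct)
  case (insert a A)
  have "(\<lambda>x. u a x + (\<Sum>k\<in>A. u k x)) \<in> polys N"
    using insert.prems by (intro polys_add insert.IH) blast+
  with insert.hyps show ?case by simp
qed (simp_all add: polys_const)

lemma polys_times_x:
  assumes "u \<in> polys N" shows "(\<lambda>x. x * u x) \<in> polys (Suc N)"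
proof -
  obtain c where c: "\<And>x. x \<in> I11 \<Longrightarrow> u x = (\<Sum>j\<le>N. c j * x ^ j)"
    using assms by (auto simp: polys_def)
  have "x * u x = (\<Sum>j\<le>Suc N. (case j of 0 \<Rightarrow> 0 | Suc i \<Rightarrow> c i) * x ^ j)" if "x \<in> I11" for x
    unfolding sum.atMost_Suc_shift using c[OF that] by (simp add: sum_distrib_left mult_ac)
  then show ?thesis by (rule polysI)
qed

lemma polys_prod_linear:
  "finite B \<Longrightarrow> (\<lambda>x. \<Prod>b\<in>B. (x - X b) * d b) \<in> polys (card B)"
proof (induction B rule: finite_induct)
  case empty
  then show ?case using polys_const[of 1 0] by simp
next
  case (insert b B)
  let ?u = "\<lambda>x. \<Prod>b\<in>B. (x - X b) * d b"
  have "(\<lambda>x. d b * (x * ?u x) + (- (d b * X b)) * ?u x) \<in> polys (Suc (card B))"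
    by (intro polys_add polys_cmult polys_times_x insert.IH polys_mono[OF _ insert.IH]) simp
  with insert.hyps show ?case by (simp add: algebra_simps)
qed

lemma polys_cheb_T: "cheb_T i \<in> polys i"
proof (induction i rule: induct_nat_012)
  case 0
  show ?case by (rule polys_cong[OF polys_const[of 1 0]]) simp
next
  case 1
  show ?case by (rule polys_cong[OF polys_times_x[OF polys_const[of 1 0]]]) (simp add: cheb_T_1)
next
  case (ge2 i)
  have "(\<lambda>x. 2 * (x * cheb_T (Suc i) x) + (-1) * cheb_T i x) \<in> polys (Suc (Suc i))"
    by (intro polys_add polys_cmult polys_times_x ge2 polys_mono[OF _ ge2(1)]) simp
  then show ?case
    by (rule polys_cong) (simp add: cheb_T_Suc_Suc)
qed

text \<open>By the recurrence, multiplication by \<open>x\<close> sends \<open>T_j\<close> to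
  \<open>(T_(j-1) + T_(j+1)) / 2\<close>, and \<open>T_0\<close> to \<open>T_1\<close>.\<close>

lemma cheb_sum_times_x:
  "\<exists>d. \<forall>x\<in>I11. x * (\<Sum>j\<le>N. c j * cheb_T j x) = (\<Sum>j\<le>Suc N. d j * cheb_T j x)"
proof (induction N)
  case 0
  show ?case
    by (intro exI[of _ "\<lambda>j. if j = 0 then 0 else c 0"]) (simp add: cheb_T_1)
next
  case (Suc N)
  then obtain d where d: "\<forall>x\<in>I11. x * (\<Sum>j\<le>N. c j * cheb_T j x) = (\<Sum>j\<le>Suc N. d j * cheb_T j x)"
    by blast
  \<comment> \<open>The new top term \<open>c (Suc N)\<close> splits into halves, placed at the
    indices \<open>N\<close> and \<open>N + 2\<close>.\<close>
  define e where "e = (\<lambda>j. (if j \<le> Suc N then d j else 0)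
    + (if j = N \<or> j = Suc (Suc N) then c (Suc N) / 2 else 0))"
  have "x * (\<Sum>j\<le>Suc N. c j * cheb_T j x) = (\<Sum>j\<le>Suc (Suc N). e j * cheb_T j x)" if x: "x \<in> I11" for x
  proof -
    have "(\<Sum>j\<le>Suc (Suc N). e j * cheb_T j x)
        = (\<Sum>j\<le>Suc N. d j * cheb_T j x) + c (Suc N) / 2 * (cheb_T N x + cheb_T (Suc (Suc N)) x)"
    proof -
      have "(\<Sum>j<N. e j * cheb_T j x) = (\<Sum>j<N. d j * cheb_T j x)"
        by (rule sum.cong) (auto simp: e_def)
      moreover have "{..N} = insert N {..<N}" by auto
      ultimately show ?thesis by (simp add: e_def algebra_simps)
    qed
    also have "\<dots> = x * (\<Sum>j\<le>N. c j * cheb_T j x) + c (Suc N) * x * cheb_T (Suc N) x"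
      using d x cheb_T_Suc_Suc[OF x, of N] by (simp add: algebra_simps)
    finally show ?thesis by (simp add: algebra_simps)
  qed
  then show ?case by blast
qed

lemma cheb_sum_power: "\<exists>d. \<forall>x\<in>I11. x ^ N = (\<Sum>j\<le>N. d j * cheb_T j x)"
proof (induction N)
  case 0
  show ?case by (intro exI[of _ "\<lambda>_. 1"]) simp
next
  case (Suc N)
  then obtain d where d: "\<forall>x\<in>I11. x ^ N = (\<Sum>j\<le>N. d j * cheb_T j x)" by blast
  obtain e where "\<forall>x\<in>I11. x * (\<Sum>j\<le>N. d j * cheb_T j x) = (\<Sum>j\<le>Suc N. e j * cheb_T j x)"
    using cheb_sum_times_x by blast
  with d show ?case by (intro exI[of _ e]) simp
qed

text \<open>Change of basis: algebra is easy with monomials, but \<open>Pi_L\<close> and the kernel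
  operators are described by their action on \<open>cheb_T\<close>.\<close>

lemma polys_cheb_sum:
  assumes "u \<in> polys N"
  obtains d where "\<And>x. x \<in> I11 \<Longrightarrow> u x = (\<Sum>j\<le>N. d j * cheb_T j x)"
proof -
  obtain c where c: "\<And>x. x \<in> I11 \<Longrightarrow> u x = (\<Sum>j\<le>N. c j * x ^ j)"
    using assms by (auto simp: polys_def)
  obtain d where d: "\<And>i x. x \<in> I11 \<Longrightarrow> x ^ i = (\<Sum>j\<le>i. d i j * cheb_T j x)"
    using cheb_sum_power by metis
  show thesis
  proof (rule that)
    fix x assume x: "x \<in> I11"
    have "u x = (\<Sum>i\<le>N. c i * (\<Sum>j\<le>N. (if j \<le> i then d i j else 0) * cheb_T j x))"
      unfolding c[OF x]
    proof (rule sum.cong[OF refl])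
      fix i assume "i \<in> {..N}"
      then have "(\<Sum>j\<le>N. (if j \<le> i then d i j else 0) * cheb_T j x) = (\<Sum>j\<le>i. d i j * cheb_T j x)"
        by (intro sum.mono_neutral_cong_right) auto
      with d[OF x, of i] show "c i * x ^ i = c i * (\<Sum>j\<le>N. (if j \<le> i then d i j else 0) * cheb_T j x)"
        by simp
    qed
    also have "\<dots> = (\<Sum>i\<le>N. \<Sum>j\<le>N. (c i * (if j \<le> i then d i j else 0)) * cheb_T j x)"
      by (simp only: sum_distrib_left mult.assoc)
    also have "\<dots> = (\<Sum>j\<le>N. (\<Sum>i\<le>N. c i * (if j \<le> i then d i j else 0)) * cheb_T j x)"
      by (subst sum.swap) (simp only: sum_distrib_right)
    finally show "u x = (\<Sum>j\<le>N. (\<Sum>i\<le>N. c i * (if j \<le> i then d i j else 0)) * cheb_T j x)" .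
  qed
qed

lemma polys_antiderivative:
  assumes "q \<in> polys d"
  obtains Q where "Q \<in> polys (Suc d)"
    "\<And>x. x \<in> I11 \<Longrightarrow> (Q has_real_derivative q x) (at x within I11)"
proof -
  obtain c where c: "\<And>x. x \<in> I11 \<Longrightarrow> q x = (\<Sum>j\<le>d. c j * x ^ j)"
    using assms by (auto simp: polys_def)
  define Q where "Q = (\<lambda>x::real. \<Sum>j\<le>d. c j / real (Suc j) * x ^ Suc j)"
  have "Q \<in> polys (Suc d)"
  proof -
    have "(\<lambda>x. x * (\<Sum>j\<le>d. c j / real (Suc j) * x ^ j)) \<in> polys (Suc d)"
      by (rule polys_times_x, rule polysI[where c = "\<lambda>j. c j / real (Suc j)"], rule refl)
    then show ?thesis by (rule polys_cong) (simp add: Q_def sum_distrib_left mult_ac)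
  qed
  moreover have "(Q has_real_derivative q x) (at x within I11)" if "x \<in> I11" for x
    unfolding Q_def c[OF that]
  proof (rule DERIV_sum)
    fix j
    have "((\<lambda>x. x ^ Suc j) has_real_derivative real (Suc j) * x ^ j) (at x within I11)"
      using DERIV_power[OF DERIV_ident, of "Suc j" x I11] by (simp del: of_nat_Suc power_Suc)
    from DERIV_cmult[OF this, of "c j / real (Suc j)"]
    show "((\<lambda>x. c j / real (Suc j) * x ^ Suc j) has_real_derivative c j * x ^ j) (at x within I11)"
      by (simp del: of_nat_Suc power_Suc)
  qed
  ultimately show thesis by (rule that)
qed

section \<open>Unisolvence of the Lissajous nodes\<close>

lemma sum_cis_roots_of_unity:
  fixes z :: int and m :: nat
  assumes "m > 0"
  shows "(\<Sum>k<m. cis (2 * pi * of_int z * real k / real m)) = (if int m dvd z then of_nat m else 0)"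
proof -
  define w where "w = cis (2 * pi * of_int z / real m)"
  have pw: "cis (2 * pi * of_int z * real k / real m) = w ^ k" for k
    by (simp add: w_def Complex.DeMoivre mult_ac)
  have wm: "w ^ m = 1"
    using assms cis_multiple_2pi[of "of_int z", OF Ints_of_int] by (simp add: w_def Complex.DeMoivre mult_ac)
  have w1: "w = 1 \<longleftrightarrow> int m dvd z"
  proof
    assume "w = 1"
    then have "cos (2 * pi * of_int z / real m) = 1"
      using arg_cong[of w 1 Re] unfolding w_def cis.sel by simp
    then obtain k :: int where "2 * pi * of_int z / real m = of_int k * 2 * pi"
      by (auto simp: cos_one_2pi_int)
    then have "(of_int z :: real) = of_int (k * int m)"
      using assms by (simp add: field_simps)
    then have "z = k * int m" by (simp only: of_int_eq_iff)
    then show "int m dvd z" by simp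
  next
    assume "int m dvd z"
    then obtain k where "z = int m * k" ..
    then show "w = 1"
      using assms cis_multiple_2pi[of "of_int k", OF Ints_of_int] by (simp add: w_def mult_ac)
  qed
  show ?thesis
  proof (cases "w = 1")
    case True
    with w1 show ?thesis by (simp add: pw)
  next
    case False
    with w1 wm show ?thesis by (simp add: pw geometric_sum)
  qed
qed

lemma sum_cos_roots_of_unity:
  fixes z :: int and m :: nat
  assumes "m > 0"
  shows "(\<Sum>k<m. cos (2 * pi * of_int z * real k / real m)) = (if int m dvd z then real m else 0)"
  using arg_cong[OF sum_cis_roots_of_unity[OF assms, of z], of Re]
  unfolding Re_sum cis.sel by (simp split: if_splits)

section \<open>The maximum norm on the square\<close>

lemma sup_norm_le: "(\<And>z. z \<in> square \<Longrightarrow> \<bar>f z\<bar> \<le> b) \<Longrightarrow> sup_norm f \<le> b"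
  unfolding sup_norm_def by (rule cSUP_least) auto

text \<open>A real \<open>SUP\<close> is an upper bound only for a bounded set; compactness of the
  square supplies this.\<close>

lemma bdd_above_abs_continuous:
  fixes f :: "real \<times> real \<Rightarrow> real"
  assumes "continuous_on square f" shows "bdd_above ((\<lambda>z. \<bar>f z\<bar>) ` square)"
proof -
  have "compact ((\<lambda>z. \<bar>f z\<bar>) ` square)"
    by (intro compact_continuous_image continuous_on_rabs[OF assms] compact_Times compact_Icc)
  then show ?thesis by (intro bounded_imp_bdd_above compact_imp_bounded)
qed

lemma abs_le_sup_norm: "continuous_on square f \<Longrightarrow> z \<in> square \<Longrightarrow> \<bar>f z\<bar> \<le> sup_norm f"
  unfolding sup_norm_def by (rule cSUP_upper[OF _ bdd_above_abs_continuous])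

lemma sup_norm_nonneg: "continuous_on square f \<Longrightarrow> 0 \<le> sup_norm f"
  using abs_le_sup_norm[of f "(0, 0)"] by fastforce

locale lissajous_params =
  fixes n p M :: nat
  assumes n_pos: "n > 0" and M_eq: "M = n + p" and coprime_n_M: "coprime n M"
begin

lemma M_pos: "M > 0"
  using n_pos by (simp add: M_eq)

text \<open>Clearing denominators turns membership into a bound on the integer frequency
  \<open>i * n + j * M\<close>, the quantity that matters along the curve.\<close>

lemma Gamma_L_iff: "(i, j) \<in> Gamma_L n p \<longleftrightarrow> i * n + j * M < n * M \<or> (i, j) = (0, n)"
proof -
  have "real i / real M + real j / real n < 1 \<longleftrightarrow> real (i * n + j * M) < real (n * M)"
    using n_pos M_pos by (simp add: field_simps)
  also have "\<dots> \<longleftrightarrow> i * n + j * M < n * M" by (simp only: of_nat_less_iff)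
  finally show ?thesis by (auto simp: Gamma_L_def M_eq)
qed

lemma Gamma_L_le:
  assumes "(i, j) \<in> Gamma_L n p"
  shows "i * n + j * M \<le> n * M" "i < M" "j \<le> n"
proof -
  show 1: "i * n + j * M \<le> n * M" using assms by (auto simp: Gamma_L_iff)
  show "i < M"
  proof (cases "(i, j) = (0, n)")
    case False
    then have "i * n + j * M < M * n" using assms by (auto simp: Gamma_L_iff mult.commute[of n])
    then have "i * n < M * n" by linarith
    then show ?thesis by (simp only: mult_less_cancel2)
  qed (use M_pos in simp)
  have "j * M \<le> n * M" using 1 by linarith
  then show "j \<le> n" using M_pos by simp
qed

lemma Gamma_L_boundary:
  assumes "(i, j) \<in> Gamma_L n p" "i * n + j * M = n * M" shows "i = 0" "j = n"
  using assms by (auto simp: Gamma_L_iff)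

lemma finite_Gamma_L: "finite (Gamma_L n p)"
proof (rule finite_subset)
  show "Gamma_L n p \<subseteq> {..M} \<times> {..n}" using Gamma_L_le by fastforce
qed simp

lemma Pi_L_iff: "P \<in> Pi_L n p \<longleftrightarrow>
    (\<exists>c. P = (\<lambda>z. \<Sum>g\<in>Gamma_L n p. c g * (cheb_T (fst g) (fst z) * cheb_T (snd g) (snd z))))"
  by (simp add: Pi_L_def case_prod_unfold)

lemma Pi_L_add:
  assumes "P \<in> Pi_L n p" "Q \<in> Pi_L n p" shows "(\<lambda>z. P z + Q z) \<in> Pi_L n p"
proof -
  obtain c d where
    "P = (\<lambda>z. \<Sum>g\<in>Gamma_L n p. c g * (cheb_T (fst g) (fst z) * cheb_T (snd g) (snd z)))"
    "Q = (\<lambda>z. \<Sum>g\<in>Gamma_L n p. d g * (cheb_T (fst g) (fst z) * cheb_T (snd g) (snd z)))"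
    using assms by (auto simp: Pi_L_iff)
  then show ?thesis
    unfolding Pi_L_iff by (intro exI[of _ "\<lambda>g. c g + d g"]) (simp add: algebra_simps sum.distrib)
qed

lemma Pi_L_cmult:
  assumes "P \<in> Pi_L n p" shows "(\<lambda>z. a * P z) \<in> Pi_L n p"
proof -
  obtain c where
    "P = (\<lambda>z. \<Sum>g\<in>Gamma_L n p. c g * (cheb_T (fst g) (fst z) * cheb_T (snd g) (snd z)))"
    using assms by (auto simp: Pi_L_iff)
  then show ?thesis
    unfolding Pi_L_iff by (intro exI[of _ "\<lambda>g. a * c g"]) (simp add: sum_distrib_left mult_ac)
qed

lemma Pi_L_zero: "(\<lambda>z. 0) \<in> Pi_L n p"
  unfolding Pi_L_iff by (intro exI[of _ "\<lambda>g. 0"]) simp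

lemma Pi_L_diff:
  assumes "P \<in> Pi_L n p" "Q \<in> Pi_L n p" shows "(\<lambda>z. P z - Q z) \<in> Pi_L n p"
  using Pi_L_add[OF assms(1) Pi_L_cmult[OF assms(2), of "-1"]] by simp

lemma Pi_L_sum:
  "(\<And>k. k \<in> A \<Longrightarrow> P k \<in> Pi_L n p) \<Longrightarrow> (\<lambda>z. \<Sum>k\<in>A. P k z) \<in> Pi_L n p"
proof (induction A rule: infinite_finite_induct)
  case (insert a A)
  have "(\<lambda>z. P a z + (\<Sum>k\<in>A. P k z)) \<in> Pi_L n p"
    using insert.prems by (intro Pi_L_add insert.IH) blast+
  with insert.hyps show ?case by simp
qed (simp_all add: Pi_L_zero)

lemma Pi_L_cheb_T:
  assumes "(i, j) \<in> Gamma_L n p" shows "(\<lambda>z. cheb_T i (fst z) * cheb_T j (snd z)) \<in> Pi_L n p"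
  unfolding Pi_L_iff
proof (intro exI ext)
  fix z :: "real \<times> real"
  have "(\<Sum>g\<in>Gamma_L n p. (if g = (i, j) then 1 else 0) * (cheb_T (fst g) (fst z) * cheb_T (snd g) (snd z)))
     = (\<Sum>g\<in>Gamma_L n p. (if g = (i, j) then cheb_T i (fst z) * cheb_T j (snd z) else 0))"
    by (rule sum.cong) auto
  then show "cheb_T i (fst z) * cheb_T j (snd z) = (\<Sum>g\<in>Gamma_L n p. (if g = (i, j) then 1 else 0)
      * (cheb_T (fst g) (fst z) * cheb_T (snd g) (snd z)))"
    using assms finite_Gamma_L by simp
qed

lemma continuous_on_Pi_L:
  assumes "P \<in> Pi_L n p" shows "continuous_on square P"
proof -
  obtain c where
    P: "P = (\<lambda>z. \<Sum>g\<in>Gamma_L n p. c g * (cheb_T (fst g) (fst z) * cheb_T (snd g) (snd z)))"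
    using assms by (auto simp: Pi_L_iff)
  show ?thesis unfolding P
    by (intro continuous_intros continuous_on_compose2[OF continuous_on_cheb_T]) auto
qed

text \<open>If the corner \<open>(I, J)\<close> lies strictly below the hypotenuse, so does the
  whole rectangle under it.\<close>

lemma Pi_L_tensor:
  assumes u: "u \<in> polys I" and v: "v \<in> polys J" and IJ: "I * n + J * M < n * M"
  shows "\<exists>P\<in>Pi_L n p. \<forall>z\<in>square. P z = u (fst z) * v (snd z)"
proof -
  obtain c where c: "\<And>x. x \<in> I11 \<Longrightarrow> u x = (\<Sum>i\<le>I. c i * cheb_T i x)"
    by (rule polys_cheb_sum[OF u]) blast
  obtain d where d: "\<And>x. x \<in> I11 \<Longrightarrow> v x = (\<Sum>j\<le>J. d j * cheb_T j x)"
    by (rule polys_cheb_sum[OF v]) blast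
  have "(i, j) \<in> Gamma_L n p" if "i \<le> I" "j \<le> J" for i j
  proof -
    have "i * n + j * M \<le> I * n + J * M"
      using that by (intro add_mono mult_right_mono) auto
    with IJ show ?thesis by (simp add: Gamma_L_iff)
  qed
  then have P: "(\<lambda>z. \<Sum>i\<le>I. \<Sum>j\<le>J. (c i * d j) * (cheb_T i (fst z) * cheb_T j (snd z))) \<in> Pi_L n p"
    by (intro Pi_L_sum Pi_L_cmult Pi_L_cheb_T) auto
  have "(\<Sum>i\<le>I. \<Sum>j\<le>J. (c i * d j) * (cheb_T i (fst z) * cheb_T j (snd z)))
      = u (fst z) * v (snd z)" if "z \<in> square" for z
  proof -
    have "fst z \<in> I11" "snd z \<in> I11" using that by auto
    then show ?thesis
      by (simp only: c d sum_product mult_ac)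
  qed
  then show ?thesis by (intro bexI[OF _ P] ballI)
qed

definition node :: "nat \<Rightarrow> real \<times> real" where
  "node k = (cos (pi * real k / real M), cos (pi * real k / real n))"

lemma LD_eq: "LD n p = node ` {..n * M}"
proof -
  have "lissajous n p (pi * real k / real (n * M)) = node k" for k
    using n_pos M_pos by (simp add: lissajous_def node_def M_eq[symmetric])
  moreover have "{0..n * M} = {..n * M}" by auto
  ultimately show ?thesis unfolding LD_def by (simp add: M_eq[symmetric])
qed

text \<open>Both cosines are unchanged under \<open>t\<close> to \<open>2 pi - t\<close>. Hence a
  full period of \<open>2 * (n * M)\<close> parameters, as orthogonality requires, still samples
  only points of \<open>LD\<close>.\<close>

lemma node_reflect:
  assumes "k \<le> 2 * (n * M)" shows "node (2 * (n * M) - k) = node k"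
proof -
  have "cos (pi * real (2 * (n * M) - k) / real M) = cos (2 * pi * real n - pi * real k / real M)"
    using n_pos M_pos assms by (simp add: of_nat_diff field_simps)
  moreover have "cos (pi * real (2 * (n * M) - k) / real n) = cos (2 * pi * real M - pi * real k / real n)"
    using n_pos M_pos assms by (simp add: of_nat_diff field_simps)
  ultimately show ?thesis
    using cos_integer_2pi[of "real n"] cos_integer_2pi[of "real M"] sin_integer_2pi[of "real n"] sin_integer_2pi[of "real M"]
    by (simp add: node_def cos_diff)
qed

lemma node_in_LD: "k < 2 * (n * M) \<Longrightarrow> node k \<in> LD n p"
proof (cases "k \<le> n * M")
  case False
  assume "k < 2 * (n * M)"
  then have "node k = node (2 * (n * M) - k)" by (simp add: node_reflect)
  moreover have "2 * (n * M) - k \<le> n * M" using False by simp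
  ultimately show ?thesis unfolding LD_eq by blast
qed (auto simp: LD_eq)

lemma LD_subset_square: "LD n p \<subseteq> square"
  by (auto simp: LD_eq node_def)

lemma finite_LD: "finite (LD n p)"
  by (simp add: LD_eq)

lemma cheb_T_node:
  "cheb_T i (fst (node k)) * cheb_T j (snd (node k))
     = cos (real (i * n) * (pi * real k / real (n * M))) * cos (real (j * M) * (pi * real k / real (n * M)))"
proof -
  have "real i * (pi * real k / real M) = real (i * n) * (pi * real k / real (n * M))"
    "real j * (pi * real k / real n) = real (j * M) * (pi * real k / real (n * M))"
    using n_pos M_pos by (simp_all add: field_simps)
  then show ?thesis by (simp only: node_def fst_conv snd_conv cheb_T_cos)
qed

section \<open>Frequencies along the curve and discrete orthogonality\<close>

lemma dvd_bounded:
  fixes a b :: int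
  assumes "b dvd a" "\<bar>a\<bar> < b" shows "a = 0"
  using assms dvd_imp_le_int[of a b] by fastforce

lemma dvd_boundary:
  fixes a N :: int
  assumes "2 * N dvd a" "- 2 * N \<le> a" "a \<le> 2 * N" "N > 0"
  shows "a = 0 \<or> a = 2 * N \<or> a = - 2 * N"
proof -
  obtain q where q: "a = 2 * N * q" using assms(1) ..
  have "- 1 \<le> q" "q \<le> 1"
  proof -
    have "2 * N * (-1) \<le> 2 * N * q" "2 * N * q \<le> 2 * N * 1" using assms(2,3) q by simp_all
    then show "- 1 \<le> q" "q \<le> 1" using assms(4) by (simp_all only: mult_le_cancel_left_pos)
  qed
  then have "q = -1 \<or> q = 0 \<or> q = 1" by linarith
  then show ?thesis using q by auto
qed

lemma coprime_solution:
  fixes a b :: int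
  assumes "a * int n = b * int M"
  shows "int M dvd a" "int n dvd b"
proof -
  have c: "coprime (int n) (int M)" using coprime_n_M by simp
  have "int M dvd a * int n" using assms by simp
  then show "int M dvd a" using c by (simp add: coprime_dvd_mult_left_iff coprime_commute)
  have "int n dvd b * int M" using assms by (metis dvd_triv_right)
  then show "int n dvd b" using c by (simp add: coprime_dvd_mult_left_iff)
qed

text \<open>The frequencies \<open>i n \<plusminus> j (n + p)\<close> of \<open>T\<^sub>i(x) T\<^sub>j(y)\<close> along the curve do not collide
  modulo \<open>2 n (n + p)\<close> with the highest frequency of another basis function.\<close>
lemma frequency_collision:
  assumes g: "(i, j) \<in> Gamma_L n p" and h: "(k, l) \<in> Gamma_L n p"
    and e: "e \<in> {1, -1 :: int}" and s: "s \<in> {1, -1 :: int}"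
    and d: "2 * (int n * int M) dvd int i * int n + s * (int j * int M) + e * (int k * int n + int l * int M)"
      (is "_ dvd ?a")
  shows "(i, j) = (k, l)"
proof -
  define N where "N = int n * int M"
  have N: "N > 0" using n_pos M_pos by (simp add: N_def)
  define x y u v where "x = int i * int n" and "y = int j * int M"
    and "u = int k * int n" and "v = int l * int M"
  note xyuv = x_def y_def u_def v_def
  have es: "e = 1 \<and> s = 1 \<or> e = 1 \<and> s = -1 \<or> e = -1 \<and> s = 1 \<or> e = -1 \<and> s = -1"
    using e s by auto
  have mono: "x + y \<le> N" "u + v \<le> N"
    using Gamma_L_le(1)[OF g] Gamma_L_le(1)[OF h] unfolding N_def xyuv
    by (metis of_nat_add of_nat_mult of_nat_le_iff)+
  have nonneg: "0 \<le> x" "0 \<le> y" "0 \<le> u" "0 \<le> v"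
    by (simp_all add: xyuv)
  have a: "?a = x + s * y + e * (u + v)" by (simp add: xyuv)
  have bounds: "- 2 * N \<le> ?a" "?a \<le> 2 * N"
    unfolding a using es mono nonneg by auto
  have lt: "int i < int M" "int k < int M" "int j \<le> int n" "int l \<le> int n"
    using Gamma_L_le[OF g] Gamma_L_le[OF h] by simp_all
  consider "?a = 0" | "?a = 2 * N \<or> ?a = - 2 * N"
    using dvd_boundary[OF d[folded N_def] bounds N] by blast
  then show ?thesis
  proof cases
    \<comment> \<open>A frequency of absolute value \<open>2 * N\<close> forces both index sums to
      be maximal, and only \<open>(0, n)\<close> attains the maximum.\<close>
    case 2
    then have "x + y = N \<and> u + v = N"
      unfolding a using es mono nonneg by auto
    then have "i * n + j * M = n * M" "k * n + l * M = n * M"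
      unfolding N_def xyuv by (metis of_nat_add of_nat_mult of_nat_eq_iff)+
    then show ?thesis using Gamma_L_boundary[OF g] Gamma_L_boundary[OF h] by simp
  next
    case 1
    \<comment> \<open>Zero frequency reads \<open>a * n = b * M\<close>. Coprimality makes
      \<open>a\<close> a multiple of \<open>M\<close>, and \<open>i, k < M\<close> leave only
      \<open>a = 0\<close> or \<open>a = M\<close>.\<close>
    define a where "a = int i + e * int k"
    define b where "b = - (s * int j + e * int l)"
    have ab: "a * int n = b * int M"
      using 1 by (simp add: a_def b_def algebra_simps)
    have Ma: "int M dvd a" and nb: "int n dvd b" using coprime_solution[OF ab] by auto
    have Mn: "int M > 0" "int n > 0" using n_pos M_pos by simp_all
    have a0: "a = 0"
    proof (rule ccontr)
      assume a: "a \<noteq> 0"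
      have "\<bar>a\<bar> < int M + int M" using e lt by (auto simp: a_def)
      have "e = 1"
      proof (rule ccontr)
        assume "e \<noteq> 1"
        then have "\<bar>a\<bar> < int M" using e lt by (auto simp: a_def)
        with dvd_bounded[OF Ma] a show False by simp
      qed
      obtain q where q: "a = int M * q" using Ma ..
      have "q = 1"
      proof -
        have "a = int i + int k" using \<open>e = 1\<close> by (simp add: a_def)
        then have "0 < a" "a < int M * 2" using a lt by linarith+
        then have "int M * 0 < int M * q" "int M * q < int M * 2" unfolding q by simp_all
        then show ?thesis using Mn(1) by (simp only: mult_less_cancel_left_pos)
      qed
      then have aM: "a = int M" using q by simp
      then have bn: "b = int n" using ab Mn by simp
      \<comment> \<open>With \<open>a = M\<close> and \<open>b = n\<close> the signs force
        \<open>j = n + l\<close>, hence \<open>j = n\<close> and \<open>l = 0\<close>; then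
        \<open>i = 0\<close>, so \<open>k = M\<close>, contradicting \<open>k < M\<close>.\<close>
      then have "s = -1" using s e lt Mn \<open>e = 1\<close> by (auto simp: b_def)
      then have "int j = int n + int l" using bn \<open>e = 1\<close> by (simp add: b_def)
      then have "j = n" "l = 0" using lt by simp_all
      then have "i = 0" using g by (auto simp: Gamma_L_iff)
      then show False using aM \<open>e = 1\<close> lt by (simp add: a_def)
    qed
    then have b0: "b = 0" using ab Mn by simp
    show ?thesis
      using a0 b0 e s by (auto simp: a_def b_def)
  qed
qed

lemma cos_mult3:
  "cos (u::real) * cos v * cos w = (cos (u + v + w) + cos (u + v - w) + cos (u - v + w) + cos (u - v - w)) / 4"
  by (simp add: cos_add cos_diff sin_add sin_diff algebra_simps)

text \<open>The test function is only the sum-frequency cosine of \<open>(k, l)\<close>. A product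
  of three cosines is an average of four, and summation over the roots of unity keeps those whose
  frequency is divisible by \<open>2 * (n * M)\<close>; \<open>frequency_collision\<close> rules
  these out for distinct indices.\<close>

lemma discrete_orthogonality:
  assumes g: "(i, j) \<in> Gamma_L n p" and h: "(k, l) \<in> Gamma_L n p"
  defines "S \<equiv> \<Sum>q<2 * (n * M). cheb_T i (fst (node q)) * cheb_T j (snd (node q))
             * cos (real (k * n + l * M) * (pi * real q / real (n * M)))"
  shows "(i, j) \<noteq> (k, l) \<Longrightarrow> S = 0" and "(i, j) = (k, l) \<Longrightarrow> S > 0"
proof -
  define a where "a = (\<lambda>(s::int) (e::int). int i * int n + s * (int j * int M) + e * (int k * int n + int l * int M))"
  define m where "m = 2 * (n * M)"
  have m: "m > 0" using n_pos M_pos by (simp add: m_def)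
  define D where "D = (\<lambda>s e. if int m dvd a s e then real m else 0)"
  have prod: "cheb_T i (fst (node q)) * cheb_T j (snd (node q))
        * cos (real (k * n + l * M) * (pi * real q / real (n * M)))
      = (cos (2 * pi * of_int (a 1 1) * real q / real m) + cos (2 * pi * of_int (a 1 (-1)) * real q / real m)
       + cos (2 * pi * of_int (a (-1) 1) * real q / real m) + cos (2 * pi * of_int (a (-1) (-1)) * real q / real m)) / 4"
    (is "?l = _") for q
  proof -
    define t where "t = pi * real q / real (n * M)"
    have t: "2 * pi * x * real q / real m = x * t" for x
      by (simp add: m_def t_def field_simps)
    have "?l = cos (real (i * n) * t) * cos (real (j * M) * t) * cos (real (k * n + l * M) * t)"
      unfolding cheb_T_node t_def by simp
    also have "\<dots> = (cos (of_int (a 1 1) * t) + cos (of_int (a 1 (-1)) * t)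
       + cos (of_int (a (-1) 1) * t) + cos (of_int (a (-1) (-1)) * t)) / 4"
      unfolding cos_mult3 by (simp add: a_def algebra_simps)
    finally show ?thesis unfolding t .
  qed
  have S: "S = (D 1 1 + D 1 (-1) + D (-1) 1 + D (-1) (-1)) / 4"
    unfolding S_def prod D_def m_def[symmetric]
    by (simp only: sum_divide_distrib[symmetric] sum.distrib sum_cos_roots_of_unity[OF m])
  have D0: "D s e = 0" if "(i, j) \<noteq> (k, l)" "s \<in> {1, -1}" "e \<in> {1, -1}" for s e
    using frequency_collision[OF g h that(3,2)] that(1) by (auto simp: D_def a_def m_def)
  show "S = 0" if "(i, j) \<noteq> (k, l)"
    unfolding S using D0[OF that] by simp
  \<comment> \<open>On the diagonal the signs \<open>s = 1\<close>, \<open>e = -1\<close> give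
    frequency zero; the other three terms cannot cancel it.\<close>
  have "D s e \<ge> 0" for s e by (simp add: D_def)
  then have "0 \<le> D 1 1" "0 \<le> D (-1) 1" "0 \<le> D (-1) (-1)" by blast+
  moreover have "D 1 (-1) > 0" if "(i, j) = (k, l)" using that m by (simp add: D_def a_def)
  ultimately show "S > 0" if "(i, j) = (k, l)"
    unfolding S using that by simp
qed

lemma Pi_L_eq_zero:
  assumes "P \<in> Pi_L n p" "\<And>A. A \<in> LD n p \<Longrightarrow> P A = 0" shows "P = (\<lambda>z. 0)"
proof -
  obtain c where
    P: "P = (\<lambda>z. \<Sum>g\<in>Gamma_L n p. c g * (cheb_T (fst g) (fst z) * cheb_T (snd g) (snd z)))"
    using assms by (auto simp: Pi_L_iff)
  have "c (k, l) = 0" if kl: "(k, l) \<in> Gamma_L n p" for k l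
  proof -
    define w where "w = (\<lambda>q. cos (real (k * n + l * M) * (pi * real q / real (n * M))))"
    define S where "S = (\<lambda>g. \<Sum>q<2 * (n * M). cheb_T (fst g) (fst (node q)) * cheb_T (snd g) (snd (node q)) * w q)"
    have "0 = (\<Sum>q<2 * (n * M). P (node q) * w q)"
      using assms(2) node_in_LD by simp
    also have "\<dots> = (\<Sum>g\<in>Gamma_L n p. c g * S g)"
      unfolding P S_def sum_distrib_left sum_distrib_right by (subst sum.swap) (simp add: mult_ac)
    also have "\<dots> = (\<Sum>g\<in>Gamma_L n p. if g = (k, l) then c g * S g else 0)"
    proof (rule sum.cong[OF refl])
      fix g assume g: "g \<in> Gamma_L n p"
      have "S g = 0" if "g \<noteq> (k, l)"
        using discrete_orthogonality(1)[of "fst g" "snd g", OF _ kl] g that unfolding S_def w_def by simp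
      then show "c g * S g = (if g = (k, l) then c g * S g else 0)" by simp
    qed
    also have "\<dots> = c (k, l) * S (k, l)"
      using kl finite_Gamma_L by simp
    finally show ?thesis
      using discrete_orthogonality(2)[OF kl kl] by (simp add: S_def w_def)
  qed
  then show ?thesis unfolding P by (intro ext sum.neutral) auto
qed

end

section \<open>Existence of the interpolant\<close>

lemma lagrange_polynomial:
  fixes X :: "nat \<Rightarrow> real"
  assumes "inj_on X {..N}" "a \<le> N"
  obtains u where "u \<in> polys N" "\<And>b. b \<le> N \<Longrightarrow> u (X b) = (if b = a then 1 else 0)"
proof
  let ?B = "{..N} - {a}"
  let ?u = "\<lambda>x. \<Prod>b\<in>?B. (x - X b) * inverse (X a - X b)"
  have "card ?B = N" using assms(2) by simp
  then show "?u \<in> polys N" using polys_prod_linear[of ?B X "\<lambda>b. inverse (X a - X b)"] by simp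
  fix b assume b: "b \<le> N"
  have "X a \<noteq> X c" if "c \<in> ?B" for c
    using inj_onD[OF assms(1), of a c] assms(2) that by auto
  then have "?u (X a) = 1" by (intro prod.neutral) auto
  moreover have "?u (X b) = 0" if "b \<noteq> a"
    using b that by (intro prod_zero) auto
  ultimately show "?u (X b) = (if b = a then 1 else 0)" by simp
qed

lemma inj_on_cos_grid: "N > 0 \<Longrightarrow> inj_on (\<lambda>a. cos (pi * real a / real N)) {..N}"
proof (rule inj_onI)
  fix a b assume N: "N > 0" and ab: "a \<in> {..N}" "b \<in> {..N}"
    and eq: "cos (pi * real a / real N) = cos (pi * real b / real N)"
  have "pi * real c / real N \<le> pi" if "c \<le> N" for c
    using that N by (simp add: field_simps)
  then have "pi * real a / real N = pi * real b / real N"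
    using ab by (intro cos_inj_pi[OF _ _ _ _ eq]) auto
  then show "a = b" using N by simp
qed

text \<open>Reduction modulo \<open>2 * N\<close> followed by the reflection \<open>r\<close> to
  \<open>2 * N - r\<close> brings every index into \<open>0..N\<close>, where the cosine is
  injective.\<close>

lemma cos_grid_reduce:
  assumes "N > 0"
  obtains a where "a \<le> N" "cos (pi * real k / real N) = cos (pi * real a / real N)"
proof -
  define r where "r = k mod (2 * N)"
  have "k = k div (2 * N) * (2 * N) + r" by (simp only: r_def div_mult_mod_eq)
  then have "real k = real (k div (2 * N)) * (2 * real N) + real r"
    by (metis of_nat_add of_nat_mult of_nat_numeral)
  then have "pi * real k / real N = 2 * pi * real (k div (2 * N)) + pi * real r / real N"
    using assms by (simp add: field_simps)
  then have kr: "cos (pi * real k / real N) = cos (pi * real r / real N)"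
    using cos_integer_2pi[of "real (k div (2 * N))"] sin_integer_2pi[of "real (k div (2 * N))"]
    by (simp add: cos_add)
  show thesis
  proof (cases "r \<le> N")
    case False
    have "r < 2 * N" using assms by (simp add: r_def)
    then have "pi * real (2 * N - r) / real N = 2 * pi - pi * real r / real N"
      using assms by (simp add: of_nat_diff field_simps)
    then have "cos (pi * real (2 * N - r) / real N) = cos (pi * real r / real N)"
      by (simp add: cos_diff)
    with kr False show thesis by (intro that[of "2 * N - r"]) auto
  qed (use kr that in blast)
qed

context lissajous_params
begin

text \<open>Reflecting either index multiplies its factor by \<open>(-1) ^ k\<close> at node
  \<open>k\<close>, and the two signs cancel.\<close>

lemma cheb_T_reflect_node:
  assumes "i \<le> M" "j \<le> n"
  shows "cheb_T (M - i) (fst (node k)) * cheb_T (n - j) (snd (node k))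
       = cheb_T i (fst (node k)) * cheb_T j (snd (node k))"
proof -
  have *: "cos (real (N - l) * (pi * real k / real N)) = (-1) ^ k * cos (real l * (pi * real k / real N))"
    if "N > 0" "l \<le> N" for N l
  proof -
    have "real (N - l) * (pi * real k / real N) = real k * pi - real l * (pi * real k / real N)"
      using that by (simp add: of_nat_diff field_simps)
    then show ?thesis by (simp add: cos_diff mult.commute[of _ pi])
  qed
  have "((-1) ^ k * (-1) ^ k :: real) = 1" by (simp add: power_mult_distrib[symmetric])
  then show ?thesis
    unfolding node_def fst_conv snd_conv cheb_T_cos *[OF M_pos assms(1)] *[OF n_pos assms(2)] by simp
qed

text \<open>Reflecting \<open>(i, j)\<close> to \<open>(n + p - i, n - j)\<close> folds the upper triangle of the full index
  rectangle onto \<open>Gamma_L\<close>.\<close>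
lemma cheb_T_on_LD:
  assumes "i \<le> M" "j \<le> n"
  shows "\<exists>P\<in>Pi_L n p. \<forall>B\<in>LD n p. P B = cheb_T i (fst B) * cheb_T j (snd B)"
proof (cases "(i, j) \<in> Gamma_L n p")
  case True
  show ?thesis by (intro bexI[OF _ Pi_L_cheb_T[OF True]] ballI refl)
next
  case False
  then have ge: "n * M \<le> i * n + j * M" and ne: "(i, j) \<noteq> (0, n)" by (auto simp: Gamma_L_iff)
  have sum: "(M - i) * n + (n - j) * M + (i * n + j * M) = 2 * (n * M)"
  proof -
    obtain a b where "M = i + a" "n = j + b"
      using assms by (auto simp: le_iff_add)
    then show ?thesis by (simp add: algebra_simps)
  qed
  have "(M - i, n - j) \<in> Gamma_L n p"
  \<comment> \<open>On the hypotenuse coprimality leaves \<open>(0, n)\<close>, which is excluded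
    here, and \<open>(M, 0)\<close>, whose reflection is \<open>(0, n)\<close>. This is why
    \<open>(0, n)\<close> has to belong to the index set.\<close>
  proof (cases "i * n + j * M = n * M")
    case True
    have "M dvd i * n"
      using True by (metis dvd_add_left_iff dvd_triv_right)
    then have "M dvd i"
      using coprime_n_M by (simp add: coprime_dvd_mult_left_iff coprime_commute)
    then have "i = 0 \<or> i = M"
      using assms(1) by (auto dest: dvd_imp_le)
    moreover have False if "i = 0"
      using True ne M_pos unfolding that by simp
    ultimately have "i = M" by blast
    then have "j = 0" using True M_pos by simp
    then show ?thesis using \<open>i = M\<close> by (simp add: Gamma_L_iff)
  next
    case False
    then have "(M - i) * n + (n - j) * M < n * M" using sum ge by linarith
    then show ?thesis by (simp add: Gamma_L_iff)
  qed
  from Pi_L_cheb_T[OF this] show ?thesis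
    by (rule bexI[rotated]) (auto simp: LD_eq cheb_T_reflect_node[OF assms])
qed

text \<open>\<open>LD\<close> lies in the product of two Chebyshev grids. The tensor Lagrange
  polynomial of that grid separates \<open>A\<close>, and each of its terms \<open>T_i T_j\<close>
  may be replaced by an element of \<open>Pi_L\<close> with the same values on
  \<open>LD\<close>.\<close>

lemma lagrange_basis_exists:
  assumes "A \<in> LD n p"
  shows "\<exists>P. P \<in> Pi_L n p \<and> (\<forall>B\<in>LD n p. P B = (if B = A then 1 else 0))"
proof -
  define X where "X = (\<lambda>N a. cos (pi * real a / real N))"
  have grid: "\<exists>a\<le>M. \<exists>b\<le>n. B = (X M a, X n b)" if B: "B \<in> LD n p" for B
  proof -
    obtain k where k: "B = node k" using B by (auto simp: LD_eq)
    obtain a where "a \<le> M" "cos (pi * real k / real M) = X M a"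
      unfolding X_def by (rule cos_grid_reduce[OF M_pos, of k])
    moreover obtain b where "b \<le> n" "cos (pi * real k / real n) = X n b"
      unfolding X_def by (rule cos_grid_reduce[OF n_pos, of k])
    ultimately show ?thesis using k unfolding node_def by blast
  qed
  obtain a b where ab: "a \<le> M" "b \<le> n" and A: "A = (X M a, X n b)" using grid[OF assms] by blast
  have inj: "inj_on (X M) {..M}" "inj_on (X n) {..n}"
    unfolding X_def using inj_on_cos_grid M_pos n_pos by blast+
  obtain u where u: "u \<in> polys M" "\<And>c. c \<le> M \<Longrightarrow> u (X M c) = (if c = a then 1 else 0)"
    using lagrange_polynomial[OF inj(1) ab(1)] by blast
  obtain v where v: "v \<in> polys n" "\<And>c. c \<le> n \<Longrightarrow> v (X n c) = (if c = b then 1 else 0)"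
    using lagrange_polynomial[OF inj(2) ab(2)] by blast
  obtain c where c: "\<And>x. x \<in> I11 \<Longrightarrow> u x = (\<Sum>i\<le>M. c i * cheb_T i x)"
    by (rule polys_cheb_sum[OF u(1)]) blast
  obtain d where d: "\<And>x. x \<in> I11 \<Longrightarrow> v x = (\<Sum>j\<le>n. d j * cheb_T j x)"
    by (rule polys_cheb_sum[OF v(1)]) blast
  obtain Q where Q: "\<And>i j. i \<le> M \<Longrightarrow> j \<le> n \<Longrightarrow> Q i j \<in> Pi_L n p"
    "\<And>i j B. i \<le> M \<Longrightarrow> j \<le> n \<Longrightarrow> B \<in> LD n p \<Longrightarrow> Q i j B = cheb_T i (fst B) * cheb_T j (snd B)"
    using cheb_T_on_LD by metis
  have "(\<lambda>z. \<Sum>i\<le>M. \<Sum>j\<le>n. (c i * d j) * Q i j z) \<in> Pi_L n p"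
    by (intro Pi_L_sum Pi_L_cmult Q) auto
  moreover have "(\<Sum>i\<le>M. \<Sum>j\<le>n. (c i * d j) * Q i j B) = (if B = A then 1 else 0)"
    if B: "B \<in> LD n p" for B
  proof -
    have I: "fst B \<in> I11" "snd B \<in> I11" using LD_subset_square B by auto
    obtain k l where kl: "k \<le> M" "l \<le> n" and Bkl: "B = (X M k, X n l)" using grid[OF B] by blast
    have "(\<Sum>i\<le>M. \<Sum>j\<le>n. (c i * d j) * Q i j B)
        = (\<Sum>i\<le>M. \<Sum>j\<le>n. (c i * d j) * (cheb_T i (fst B) * cheb_T j (snd B)))"
      by (intro sum.cong refl) (simp add: Q(2) B)
    also have "\<dots> = u (fst B) * v (snd B)"
      by (simp only: c[OF I(1)] d[OF I(2)] sum_product mult_ac)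
    also have "\<dots> = (if k = a \<and> l = b then 1 else 0)"
      using u(2)[OF kl(1)] v(2)[OF kl(2)] by (simp add: Bkl)
    also have "k = a \<and> l = b \<longleftrightarrow> B = A"
      using inj_on_eq_iff[OF inj(1), of k a] inj_on_eq_iff[OF inj(2), of l b] kl ab by (simp add: Bkl A)
    finally show ?thesis .
  qed
  ultimately show ?thesis by (intro exI conjI ballI)
qed

section \<open>The interpolation projection, its Lebesgue constant and best approximation\<close>

definition lagrange_basis :: "real \<times> real \<Rightarrow> real \<times> real \<Rightarrow> real" where
  "lagrange_basis A = (SOME P. P \<in> Pi_L n p \<and> (\<forall>B\<in>LD n p. P B = (if B = A then 1 else 0)))"

lemma lagrange_basis:
  assumes "A \<in> LD n p"
  shows "lagrange_basis A \<in> Pi_L n p"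
    "\<And>B. B \<in> LD n p \<Longrightarrow> lagrange_basis A B = (if B = A then 1 else 0)"
  using someI_ex[OF lagrange_basis_exists[OF assms]] by (simp_all add: lagrange_basis_def)

lemma Pi_L_unique:
  assumes "P \<in> Pi_L n p" "Q \<in> Pi_L n p" "\<And>A. A \<in> LD n p \<Longrightarrow> P A = Q A" shows "P = Q"
proof -
  have "(\<lambda>z. P z - Q z) = (\<lambda>z. 0)"
    using assms by (intro Pi_L_eq_zero Pi_L_diff) auto
  then show ?thesis by (simp add: fun_eq_iff)
qed

text \<open>Resolves the definite description into an explicit formula, from which linearity and
  boundedness are read off.\<close>

lemma interp_eq: "interp n p f = (\<lambda>z. \<Sum>A\<in>LD n p. f A * lagrange_basis A z)"
proof -
  have 1: "(\<lambda>z. \<Sum>A\<in>LD n p. f A * lagrange_basis A z) \<in> Pi_L n p" (is "?P \<in> _")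
    by (intro Pi_L_sum Pi_L_cmult lagrange_basis)
  have 2: "?P B = f B" if B: "B \<in> LD n p" for B
  proof -
    have "?P B = (\<Sum>A\<in>LD n p. if B = A then f A else 0)"
      by (rule sum.cong) (simp_all add: lagrange_basis(2) B)
    then show ?thesis using B finite_LD by simp
  qed
  show ?thesis unfolding interp_def
    by (rule the_equality) (use 1 2 Pi_L_unique in auto)
qed

lemma interp_in_Pi_L: "interp n p f \<in> Pi_L n p"
  unfolding interp_eq by (intro Pi_L_sum Pi_L_cmult lagrange_basis)

lemma interp_at_node: "B \<in> LD n p \<Longrightarrow> interp n p f B = f B"
proof -
  assume B: "B \<in> LD n p"
  have "interp n p f B = (\<Sum>A\<in>LD n p. if B = A then f A else 0)"
    unfolding interp_eq by (rule sum.cong) (simp_all add: lagrange_basis(2) B)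
  then show ?thesis using B finite_LD by simp
qed

lemma interp_Pi_L: "P \<in> Pi_L n p \<Longrightarrow> interp n p P = P"
  by (intro Pi_L_unique interp_in_Pi_L) (simp_all add: interp_at_node)

lemma interp_diff: "interp n p (\<lambda>z. f z - g z) z = interp n p f z - interp n p g z"
  by (simp add: interp_eq left_diff_distrib sum_subtractf)

lemma interp_cmult: "interp n p (\<lambda>z. a * f z) z = a * interp n p f z"
  by (simp add: interp_eq sum_distrib_left mult_ac)

text \<open>The crude bound makes the set in \<open>lebesgue_const\<close> bounded above, so that
  its supremum is meaningful.\<close>

lemma interp_bounded:
  assumes "continuous_on square f"
  shows "sup_norm (interp n p f) \<le> sup_norm f * (\<Sum>A\<in>LD n p. sup_norm (lagrange_basis A))"
proof (rule sup_norm_le)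
  fix z assume z: "z \<in> square"
  have "\<bar>interp n p f z\<bar> \<le> (\<Sum>A\<in>LD n p. \<bar>f A\<bar> * \<bar>lagrange_basis A z\<bar>)"
    unfolding interp_eq by (rule order_trans[OF sum_abs]) (simp add: abs_mult)
  also have "\<dots> \<le> (\<Sum>A\<in>LD n p. sup_norm f * sup_norm (lagrange_basis A))"
  proof (intro sum_mono mult_mono)
    fix A assume A: "A \<in> LD n p"
    then show "\<bar>f A\<bar> \<le> sup_norm f" using LD_subset_square assms by (intro abs_le_sup_norm) auto
    show "\<bar>lagrange_basis A z\<bar> \<le> sup_norm (lagrange_basis A)"
      by (intro abs_le_sup_norm continuous_on_Pi_L lagrange_basis A z)
  qed (simp_all add: sup_norm_nonneg assms)
  finally show "\<bar>interp n p f z\<bar> \<le> sup_norm f * (\<Sum>A\<in>LD n p. sup_norm (lagrange_basis A))"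
    by (simp add: sum_distrib_left)
qed

lemma sup_norm_interp_le_lebesgue_const:
  assumes "continuous_on square f" "sup_norm f \<le> 1"
  shows "sup_norm (interp n p f) \<le> lebesgue_const n p"
  unfolding lebesgue_const_def
proof (rule cSUP_upper)
  show "f \<in> {f. continuous_on square f \<and> sup_norm f \<le> 1}" using assms by simp
  show "bdd_above ((\<lambda>f. sup_norm (interp n p f)) ` {f. continuous_on square f \<and> sup_norm f \<le> 1})"
  proof (rule bdd_aboveI2)
    fix f assume f: "f \<in> {f. continuous_on square f \<and> sup_norm f \<le> 1}"
    have "sup_norm f * (\<Sum>A\<in>LD n p. sup_norm (lagrange_basis A))
        \<le> 1 * (\<Sum>A\<in>LD n p. sup_norm (lagrange_basis A))"
      using f by (intro mult_right_mono sum_nonneg sup_norm_nonneg continuous_on_Pi_L lagrange_basis) auto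
    with interp_bounded[of f] f
    show "sup_norm (interp n p f) \<le> 1 * (\<Sum>A\<in>LD n p. sup_norm (lagrange_basis A))" by simp
  qed
qed

lemma lebesgue_const_nonneg: "0 \<le> lebesgue_const n p"
proof -
  have "sup_norm (interp n p (\<lambda>z. 0)) \<le> lebesgue_const n p"
    by (rule sup_norm_interp_le_lebesgue_const) (auto intro!: sup_norm_le)
  moreover have "0 \<le> sup_norm (interp n p (\<lambda>z. 0))"
    by (intro sup_norm_nonneg continuous_on_Pi_L interp_in_Pi_L)
  ultimately show ?thesis by simp
qed

lemma abs_interp_le:
  assumes f: "continuous_on square f" and z: "z \<in> square"
  shows "\<bar>interp n p f z\<bar> \<le> lebesgue_const n p * sup_norm f"
proof (cases "sup_norm f = 0")
  \<comment> \<open>Here \<open>f\<close> cannot be scaled to norm one, but it vanishes at every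
    node, so the interpolant is zero.\<close>
  case True
  have "f A = 0" if "A \<in> LD n p" for A
    using abs_le_sup_norm[OF f, of A] LD_subset_square that True by auto
  then show ?thesis using True by (simp add: interp_eq)
next
  case False
  define a where "a = 1 / sup_norm f"
  have pos: "sup_norm f > 0" using sup_norm_nonneg[OF f] False by simp
  have cont: "continuous_on square (\<lambda>z. a * f z)" by (intro continuous_intros f)
  have "\<bar>a * f z\<bar> \<le> 1" if "z \<in> square" for z
    using abs_le_sup_norm[OF f that] pos by (simp add: a_def abs_mult)
  then have "sup_norm (\<lambda>z. a * f z) \<le> 1" by (rule sup_norm_le)
  then have "sup_norm (interp n p (\<lambda>z. a * f z)) \<le> lebesgue_const n p"
    by (rule sup_norm_interp_le_lebesgue_const[OF cont])
  moreover have "\<bar>interp n p (\<lambda>z. a * f z) z\<bar> \<le> sup_norm (interp n p (\<lambda>z. a * f z))"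
    by (intro abs_le_sup_norm continuous_on_Pi_L interp_in_Pi_L z)
  ultimately have "\<bar>a * interp n p f z\<bar> \<le> lebesgue_const n p" by (simp add: interp_cmult)
  then show ?thesis using pos by (simp add: a_def abs_mult field_simps)
qed

lemma best_approx_nonneg:
  assumes "continuous_on square f" shows "0 \<le> best_approx n p f"
  unfolding best_approx_def
proof (rule cINF_greatest)
  show "Pi_L n p \<noteq> {}" using Pi_L_zero by blast
qed (intro sup_norm_nonneg continuous_intros assms continuous_on_Pi_L)

lemma best_approx_le:
  assumes "continuous_on square f" "P \<in> Pi_L n p" "\<And>z. z \<in> square \<Longrightarrow> \<bar>f z - P z\<bar> \<le> b"
  shows "best_approx n p f \<le> b"
proof -
  have "bdd_below ((\<lambda>P. sup_norm (\<lambda>z. f z - P z)) ` Pi_L n p)"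
    by (rule bdd_belowI2[where m = 0]) (intro sup_norm_nonneg continuous_intros assms continuous_on_Pi_L)
  then have "best_approx n p f \<le> sup_norm (\<lambda>z. f z - P z)"
    unfolding best_approx_def using assms(2) by (intro cINF_lower)
  also have "\<dots> \<le> b" using assms(3) by (rule sup_norm_le)
  finally show ?thesis .
qed

text \<open>For every \<open>P\<close> in the space, \<open>f - L f = (f - P) - L (f - P)\<close>.
  Dividing by \<open>K > 0\<close> lets the resulting bound pass to the infimum over
  \<open>P\<close>.\<close>

lemma interp_error_le:
  assumes f: "continuous_on square f" and K: "lebesgue_const n p + 1 \<le> K"
  shows "sup_norm (\<lambda>z. f z - interp n p f z) \<le> K * best_approx n p f"
proof -
  have Kpos: "K > 0" using K lebesgue_const_nonneg by linarith
  have "sup_norm (\<lambda>z. f z - interp n p f z) / K \<le> best_approx n p f"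
    unfolding best_approx_def
  proof (rule cINF_greatest)
    show "Pi_L n p \<noteq> {}" using Pi_L_zero by blast
    fix P assume P: "P \<in> Pi_L n p"
    have c: "continuous_on square (\<lambda>z. f z - P z)" by (intro continuous_intros f continuous_on_Pi_L P)
    have "\<bar>f z - interp n p f z\<bar> \<le> K * sup_norm (\<lambda>z. f z - P z)" if z: "z \<in> square" for z
    proof -
      have "f z - interp n p f z = (f z - P z) - interp n p (\<lambda>z. f z - P z) z"
        by (simp add: interp_diff interp_Pi_L[OF P])
      also have "\<bar>\<dots>\<bar> \<le> \<bar>f z - P z\<bar> + \<bar>interp n p (\<lambda>z. f z - P z) z\<bar>"
        by (rule abs_triangle_ineq4)
      also have "\<dots> \<le> sup_norm (\<lambda>z. f z - P z) + lebesgue_const n p * sup_norm (\<lambda>z. f z - P z)"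
        by (intro add_mono abs_le_sup_norm[OF c z] abs_interp_le[OF c z])
      also have "\<dots> = (lebesgue_const n p + 1) * sup_norm (\<lambda>z. f z - P z)" by (simp add: algebra_simps)
      also have "\<dots> \<le> K * sup_norm (\<lambda>z. f z - P z)"
        by (intro mult_right_mono K sup_norm_nonneg c)
      finally show ?thesis .
    qed
    then have "sup_norm (\<lambda>z. f z - interp n p f z) \<le> K * sup_norm (\<lambda>z. f z - P z)"
      by (rule sup_norm_le)
    then show "sup_norm (\<lambda>z. f z - interp n p f z) / K \<le> sup_norm (\<lambda>z. f z - P z)"
      using Kpos by (simp add: field_simps)
  qed
  then show ?thesis using Kpos by (simp add: field_simps)
qed

end

section \<open>Discrete kernel operators\<close>

text \<open>A kernel operator with the autocorrelation of the weights \<open>a\<close> as multiplier: positivity comes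
  from \<open>\<Sum>\<^sub>k\<^sub>l a\<^sub>k a\<^sub>l cos ((k - l) t) = |\<Sum>\<^sub>k a\<^sub>k e\<^bsup>ikt\<^esup>|\<^sup>2\<close>, and sampling at the \<open>m\<close>-th roots
  of unity is exact for low frequencies.\<close>

definition sqkernel :: "(nat \<Rightarrow> real) \<Rightarrow> nat \<Rightarrow> real \<Rightarrow> real \<Rightarrow> real" where
  "sqkernel a N \<theta> \<phi> = (\<Sum>k<N. \<Sum>l<N. a k * a l * (cos ((real k - real l) * \<theta>) * cos ((real k - real l) * \<phi>)))"

lemma sqkernel_nonneg: "0 \<le> sqkernel a N \<theta> \<phi>"
proof -
  define K where "K = (\<lambda>t. \<Sum>k<N. \<Sum>l<N. a k * a l * cos ((real k - real l) * t))"
  have "K t = (\<Sum>k<N. a k * cos (real k * t))\<^sup>2 + (\<Sum>k<N. a k * sin (real k * t))\<^sup>2" for t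
    unfolding K_def power2_eq_square sum_product sum.distrib[symmetric]
    by (intro sum.cong refl) (simp add: left_diff_distrib cos_diff algebra_simps)
  then have K: "0 \<le> K t" for t by simp
  \<comment> \<open>Symmetrising the translation kernel \<open>K\<close> in \<open>\<phi>\<close>
    makes it even in both angles, hence a function of their cosines.\<close>
  have "cos (z * \<theta>) * cos (z * \<phi>) = (cos (z * (\<theta> - \<phi>)) + cos (z * (\<theta> + \<phi>))) / 2" for z :: real
    by (simp add: right_diff_distrib distrib_left cos_diff cos_add)
  then have "sqkernel a N \<theta> \<phi> = (K (\<theta> - \<phi>) + K (\<theta> + \<phi>)) / 2"
    unfolding sqkernel_def K_def sum.distrib[symmetric] sum_divide_distrib
    by (simp only: distrib_left times_divide_eq_right)
  then show ?thesis using K[of "\<theta> - \<phi>"] K[of "\<theta> + \<phi>"] by simp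
qed

definition autocorr :: "(nat \<Rightarrow> real) \<Rightarrow> nat \<Rightarrow> nat \<Rightarrow> real" where
  "autocorr a N i = (\<Sum>k\<in>{k. k + i < N}. a k * a (k + i))"

definition grid_angle :: "nat \<Rightarrow> nat \<Rightarrow> real" where
  "grid_angle m q = 2 * pi * real q / real m"

text \<open>The condition \<open>z + i < m\<close> excludes aliasing: \<open>m\<close> divides
  \<open>z - i\<close> or \<open>z + i\<close> only if that number is zero.\<close>

lemma sum_cos_cos_grid:
  fixes z i m :: nat
  assumes "z + i < m"
  shows "(\<Sum>q<m. cos (real z * grid_angle m q) * cos (real i * grid_angle m q)) / real m
       = (if z = i then (if i = 0 then 1 else 1/2) else 0)"
proof -
  have m: "m > 0" using assms by simp
  have "cos (real z * grid_angle m q) * cos (real i * grid_angle m q)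
      = (cos (2 * pi * of_int (int z - int i) * real q / real m)
         + cos (2 * pi * of_int (int z + int i) * real q / real m)) / 2" for q
  proof -
    have "real z * grid_angle m q - real i * grid_angle m q = 2 * pi * of_int (int z - int i) * real q / real m"
      "real z * grid_angle m q + real i * grid_angle m q = 2 * pi * of_int (int z + int i) * real q / real m"
      using m by (simp_all add: grid_angle_def field_simps)
    then show ?thesis by (simp only: cos_times_cos)
  qed
  then have "(\<Sum>q<m. cos (real z * grid_angle m q) * cos (real i * grid_angle m q))
      = ((if int m dvd int z - int i then real m else 0) + (if int m dvd int z + int i then real m else 0)) / 2"
    by (simp only: sum_divide_distrib[symmetric] sum.distrib sum_cos_roots_of_unity[OF m])
  moreover have "int m dvd int z - int i \<longleftrightarrow> z = i"
  proof
    assume *: "int m dvd int z - int i"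
    show "z = i"
    proof (rule ccontr)
      assume "z \<noteq> i"
      then have "\<bar>int m\<bar> \<le> \<bar>int z - int i\<bar>" using * by (intro dvd_imp_le_int) auto
      then show False using assms by linarith
    qed
  qed simp
  moreover have "int m dvd int z + int i \<longleftrightarrow> z = 0 \<and> i = 0"
  proof
    assume *: "int m dvd int z + int i"
    show "z = 0 \<and> i = 0"
    proof (rule ccontr)
      assume "\<not> (z = 0 \<and> i = 0)"
      then have "\<bar>int m\<bar> \<le> \<bar>int z + int i\<bar>" using * by (intro dvd_imp_le_int) auto
      then show False using assms by linarith
    qed
  qed simp
  ultimately show ?thesis using m by (auto simp: field_simps)
qed

text \<open>This is \<open>|k - l|\<close>, since one truncated difference is always zero; as a
  natural number it can index \<open>cheb_T\<close>.\<close>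

definition nat_dist :: "nat \<Rightarrow> nat \<Rightarrow> nat" where
  "nat_dist k l = (k - l) + (l - k)"

lemma cos_nat_dist: "cos ((real k - real l) * t) = cos (real (nat_dist k l) * t)"
proof (cases "l \<le> k")
  case False
  then have "(real k - real l) * t = - (real (nat_dist k l) * t)"
    by (simp add: nat_dist_def of_nat_diff algebra_simps)
  then show ?thesis by simp
qed (simp add: nat_dist_def of_nat_diff)

text \<open>For \<open>i > 0\<close> the pairs at distance \<open>i\<close> occur in mirror images,
  which compensates the weight 1/2; for \<open>i = 0\<close> both orders coincide on the
  diagonal.\<close>

lemma sum_nat_dist:
  "(\<Sum>k<N. \<Sum>l<N. if nat_dist k l = i then a k * a l * (if i = 0 then 1 else 1/2) else 0) = autocorr a N i"
proof -
  have *: "(\<Sum>k<N. \<Sum>l<N. if l = k + i then a k * a l else 0) = autocorr a N i"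
  proof -
    have "(\<Sum>k<N. \<Sum>l<N. if l = k + i then a k * a l else 0) = (\<Sum>k<N. if k + i < N then a k * a (k + i) else 0)"
      by (intro sum.cong refl) simp
    also have "\<dots> = autocorr a N i"
      unfolding autocorr_def by (subst sum.inter_filter[symmetric]) (auto intro!: sum.cong)
    finally show ?thesis .
  qed
  then have **: "(\<Sum>k<N. \<Sum>l<N. if k = l + i then a k * a l else 0) = autocorr a N i"
    by (subst sum.swap) (simp only: mult.commute)
  have "(\<Sum>k<N. \<Sum>l<N. if nat_dist k l = i then a k * a l * (if i = 0 then 1 else 1/2) else 0)
     = ((\<Sum>k<N. \<Sum>l<N. if l = k + i then a k * a l else 0) + (\<Sum>k<N. \<Sum>l<N. if k = l + i then a k * a l else 0)) / 2"
    unfolding sum.distrib[symmetric] sum_divide_distrib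
    by (intro sum.cong refl) (auto simp: nat_dist_def split: if_splits)
  then show ?thesis using * ** by simp
qed

text \<open>The integral of a function against the kernel is replaced by the average over
  \<open>m\<close> equispaced angles.\<close>

definition kernel_weight :: "(nat \<Rightarrow> real) \<Rightarrow> nat \<Rightarrow> nat \<Rightarrow> nat \<Rightarrow> real \<Rightarrow> real" where
  "kernel_weight a N m q x = sqkernel a N (arccos x) (grid_angle m q) / real m"

lemma kernel_weight_nonneg: "0 \<le> kernel_weight a N m q x"
  by (simp add: kernel_weight_def sqkernel_nonneg)

lemma polys_kernel_weight:
  assumes "N \<le> Suc d" shows "kernel_weight a N m q \<in> polys d"
proof -
  have eq: "kernel_weight a N m q = (\<lambda>x. \<Sum>k<N. \<Sum>l<N.
      (a k * a l * cos (real (nat_dist k l) * grid_angle m q) / real m) * cheb_T (nat_dist k l) x)"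
  proof (rule ext)
    fix x
    show "kernel_weight a N m q x = (\<Sum>k<N. \<Sum>l<N.
      (a k * a l * cos (real (nat_dist k l) * grid_angle m q) / real m) * cheb_T (nat_dist k l) x)"
      unfolding kernel_weight_def sqkernel_def cos_nat_dist cheb_T_def sum_divide_distrib
      by (simp add: mult_ac)
  qed
  have "nat_dist k l \<le> d" if "k < N" "l < N" for k l
    using that assms by (simp add: nat_dist_def)
  then show ?thesis
    unfolding eq by (intro polys_sum polys_cmult polys_mono[OF _ polys_cheb_T]) auto
qed

text \<open>Kernel frequencies are at most \<open>N - 1\<close>, so \<open>N + i <= m\<close> keeps
  the sampling free of aliasing and the operator is diagonal on \<open>cheb_T\<close>.\<close>

lemma kernel_weight_cheb_T:
  assumes "N + i \<le> m" "0 < N"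
  shows "(\<Sum>q<m. cheb_T i (cos (grid_angle m q)) * kernel_weight a N m q x) = autocorr a N i * cheb_T i x"
proof -
  define c where "c = (\<lambda>k l. a k * a l * cos (real (nat_dist k l) * arccos x))"
  have "(\<Sum>q<m. cheb_T i (cos (grid_angle m q)) * kernel_weight a N m q x)
     = (\<Sum>k<N. \<Sum>l<N. c k l * ((\<Sum>q<m. cos (real (nat_dist k l) * grid_angle m q) * cos (real i * grid_angle m q)) / real m))"
  proof -
    have "(\<Sum>q<m. cheb_T i (cos (grid_angle m q)) * kernel_weight a N m q x)
       = (\<Sum>q<m. \<Sum>k<N. \<Sum>l<N. c k l * (cos (real (nat_dist k l) * grid_angle m q) * cos (real i * grid_angle m q)) / real m)"
      unfolding kernel_weight_def sqkernel_def cheb_T_cos cos_nat_dist c_def sum_divide_distrib sum_distrib_left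
      by (intro sum.cong refl) simp
    also have "\<dots> = (\<Sum>k<N. \<Sum>l<N. \<Sum>q<m. c k l * (cos (real (nat_dist k l) * grid_angle m q) * cos (real i * grid_angle m q)) / real m)"
      by (subst sum.swap, rule sum.cong[OF refl], rule sum.swap)
    finally show ?thesis by (simp add: sum_distrib_left sum_divide_distrib)
  qed
  also have "\<dots> = (\<Sum>k<N. \<Sum>l<N. (if nat_dist k l = i then a k * a l * (if i = 0 then 1 else 1/2) else 0) * cheb_T i x)"
  proof (intro sum.cong refl)
    fix k l assume "k \<in> {..<N}" "l \<in> {..<N}"
    then have "nat_dist k l + i < m" using assms by (auto simp: nat_dist_def)
    then show "c k l * ((\<Sum>q<m. cos (real (nat_dist k l) * grid_angle m q) * cos (real i * grid_angle m q)) / real m)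
       = (if nat_dist k l = i then a k * a l * (if i = 0 then 1 else 1/2) else 0) * cheb_T i x"
      by (simp add: sum_cos_cos_grid c_def cheb_T_def)
  qed
  also have "\<dots> = autocorr a N i * cheb_T i x"
    by (simp only: sum_distrib_right[symmetric] sum_nat_dist)
  finally show ?thesis .
qed

lemma sum_kernel_weight:
  assumes "N \<le> m" "0 < N"
  shows "(\<Sum>q<m. kernel_weight a N m q x) = autocorr a N 0"
  using kernel_weight_cheb_T[of N 0 m a x] assms by simp

text \<open>The de la Vallee-Poussin operator: a difference of two Fejer kernels \<open>a = 1\<close>.\<close>
lemma quasi_interpolation:
  assumes LI: "L \<le> I"
  obtains m :: nat and X :: "nat \<Rightarrow> real" and \<phi> :: "nat \<Rightarrow> real \<Rightarrow> real" where
    "\<And>q. X q \<in> I11" "\<And>q. \<phi> q \<in> polys I"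
    "\<And>u x. u \<in> polys L \<Longrightarrow> x \<in> I11 \<Longrightarrow> (\<Sum>q<m. u (X q) * \<phi> q x) = u x"
    "\<And>x. (\<Sum>q<m. \<bar>\<phi> q x\<bar>) \<le> real (I + 1 + L) / real (I + 1 - L)"
proof -
  \<comment> \<open>Large enough for sampling to be exact for kernels up to \<open>N = I + 1\<close>
    on inputs of degree at most \<open>I\<close>.\<close>
  define m where "m = 2 * (I + 1)"
  define X where "X = (\<lambda>q. cos (grid_angle m q))"
  define D where "D = (\<lambda>N. kernel_weight (\<lambda>_. 1) N m)"
  define h where "h = inverse (real (I + 1 - L))"
  have h: "h > 0" using LI by (simp add: h_def)
  \<comment> \<open>The Fejer multipliers \<open>I + 1 - i\<close> and \<open>L - i\<close> differ
    by the constant \<open>I + 1 - L\<close> for all \<open>i <= L\<close>; dividing by it gives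
    reproduction of degree \<open>L\<close>.\<close>
  define \<phi> where "\<phi> = (\<lambda>q x. h * (D (I + 1) q x + (-1) * D L q x))"
  have ac: "autocorr (\<lambda>_. 1) N i = real (N - i)" for N i
  proof -
    have "{k. k + i < N} = {..<N - i}" by auto
    then show ?thesis by (simp add: autocorr_def)
  qed
  have DT: "(\<Sum>q<m. cheb_T i (X q) * D N q x) = real (N - i) * cheb_T i x" if "N \<le> I + 1" "i \<le> I" for N i x
  proof (cases "N = 0")
    case True
    then show ?thesis by (simp add: D_def kernel_weight_def sqkernel_def)
  next
    case False
    with that show ?thesis
      unfolding X_def D_def using kernel_weight_cheb_T[of N i m "\<lambda>_. 1" x] by (simp add: ac m_def)
  qed
  have DS: "(\<Sum>q<m. D N q x) = real N" if "N \<le> I + 1" for N x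
    using DT[OF that, of 0] by simp
  show thesis
  proof (rule that)
    show "X q \<in> I11" for q by (simp add: X_def)
    show "\<phi> q \<in> polys I" for q
      unfolding \<phi>_def D_def using LI by (intro polys_cmult polys_add polys_kernel_weight) auto
    show "(\<Sum>q<m. u (X q) * \<phi> q x) = u x" if u: "u \<in> polys L" and x: "x \<in> I11" for u x
    proof -
      obtain c where c: "\<And>x. x \<in> I11 \<Longrightarrow> u x = (\<Sum>i\<le>L. c i * cheb_T i x)"
        by (rule polys_cheb_sum[OF u]) blast
      have T: "(\<Sum>q<m. cheb_T i (X q) * \<phi> q x) = cheb_T i x" if "i \<le> L" for i
      proof -
        have "(\<Sum>q<m. cheb_T i (X q) * \<phi> q x)
           = h * ((\<Sum>q<m. cheb_T i (X q) * D (I + 1) q x) - (\<Sum>q<m. cheb_T i (X q) * D L q x))"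
          by (simp add: \<phi>_def algebra_simps sum_distrib_left sum.distrib sum_subtractf)
        also have "\<dots> = h * (real (I + 1 - i) - real (L - i)) * cheb_T i x"
        proof -
          have e: "(\<Sum>q<m. cheb_T i (X q) * D (I + 1) q x) = real (I + 1 - i) * cheb_T i x"
            "(\<Sum>q<m. cheb_T i (X q) * D L q x) = real (L - i) * cheb_T i x"
            using that LI by (intro DT; simp)+
          show ?thesis unfolding e by (simp only: left_diff_distrib right_diff_distrib mult.assoc)
        qed
        also have "real (I + 1 - i) - real (L - i) = real (I + 1 - L)"
          using that LI by (simp add: of_nat_diff)
        finally show ?thesis using h by (simp add: h_def)
      qed
      have "u (X q) * \<phi> q x = (\<Sum>i\<le>L. c i * (cheb_T i (X q) * \<phi> q x))" for q
        using c[of "X q"] by (simp add: X_def sum_distrib_right mult.assoc)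
      then have "(\<Sum>q<m. u (X q) * \<phi> q x) = (\<Sum>q<m. \<Sum>i\<le>L. c i * (cheb_T i (X q) * \<phi> q x))"
        by simp
      also have "\<dots> = (\<Sum>i\<le>L. c i * (\<Sum>q<m. cheb_T i (X q) * \<phi> q x))"
        by (subst sum.swap) (simp add: sum_distrib_left)
      also have "\<dots> = u x" by (simp add: T c[OF x])
      finally show ?thesis .
    qed
    show "(\<Sum>q<m. \<bar>\<phi> q x\<bar>) \<le> real (I + 1 + L) / real (I + 1 - L)" for x
    proof -
      \<comment> \<open>Both Fejer kernels are nonnegative with masses \<open>I + 1\<close> and
        \<open>L\<close>, so the absolute sum of the difference is at most the sum of the masses,
        times \<open>h\<close>.\<close>
      have "(\<Sum>q<m. \<bar>\<phi> q x\<bar>) \<le> (\<Sum>q<m. h * (D (I + 1) q x + D L q x))"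
      proof (rule sum_mono)
        fix q
        have "0 \<le> D (I + 1) q x" "0 \<le> D L q x" by (simp_all add: D_def kernel_weight_nonneg)
        then have "\<bar>D (I + 1) q x + (-1) * D L q x\<bar> \<le> D (I + 1) q x + D L q x" by linarith
        then show "\<bar>\<phi> q x\<bar> \<le> h * (D (I + 1) q x + D L q x)"
          using h by (simp add: \<phi>_def abs_mult)
      qed
      also have "\<dots> = h * (real (I + 1) + real L)"
        using DS[of "I + 1" x] DS[of L x] LI by (simp add: sum_distrib_left[symmetric] sum.distrib)
      finally show ?thesis by (simp add: h_def field_simps)
    qed
  qed
qed

lemma quasi_interpolation_error:
  fixes g :: "real \<Rightarrow> real"
  assumes rep: "\<And>u x. u \<in> polys L \<Longrightarrow> x \<in> I11 \<Longrightarrow> (\<Sum>q<m. u (X q) * \<phi> q x) = u x"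
    and X: "\<And>q. X q \<in> I11" and bd: "\<And>x. (\<Sum>q<m. \<bar>\<phi> q x\<bar>) \<le> K"
    and u: "u \<in> polys L" and e: "\<And>x. x \<in> I11 \<Longrightarrow> \<bar>g x - u x\<bar> \<le> e" and x: "x \<in> I11"
  shows "\<bar>g x - (\<Sum>q<m. g (X q) * \<phi> q x)\<bar> \<le> (1 + K) * e"
proof -
  have e0: "0 \<le> e" using e[OF x] by linarith
  have "\<bar>\<Sum>q<m. (g (X q) - u (X q)) * \<phi> q x\<bar> \<le> (\<Sum>q<m. e * \<bar>\<phi> q x\<bar>)"
    by (rule order_trans[OF sum_abs], rule sum_mono)
      (auto simp: abs_mult intro!: mult_right_mono e X)
  also have "\<dots> \<le> K * e"
    using mult_right_mono[OF bd[of x] e0] by (simp add: sum_distrib_left[symmetric] mult.commute)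
  finally have "\<bar>\<Sum>q<m. (g (X q) - u (X q)) * \<phi> q x\<bar> \<le> K * e" .
  moreover have "g x - (\<Sum>q<m. g (X q) * \<phi> q x) = (g x - u x) - (\<Sum>q<m. (g (X q) - u (X q)) * \<phi> q x)"
    using rep[OF u x] by (simp add: left_diff_distrib sum_subtractf)
  ultimately show ?thesis using e[OF x] by (simp add: algebra_simps abs_if split: if_splits)
qed

section \<open>Majorants from a modulus of continuity\<close>

lemma modulus_steps:
  fixes g :: "real \<Rightarrow> real"
  assumes "\<delta> > 0" and w: "\<And>x y. x \<in> I11 \<Longrightarrow> y \<in> I11 \<Longrightarrow> \<bar>x - y\<bar> \<le> \<delta> \<Longrightarrow> \<bar>g x - g y\<bar> \<le> w"
    and "x \<in> I11" "y \<in> I11" "\<bar>x - y\<bar> \<le> real k * \<delta>"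
  shows "\<bar>g x - g y\<bar> \<le> real k * w"
  using assms(4,5)
proof (induction k arbitrary: y)
  case (Suc k)
  \<comment> \<open>The point \<open>z\<close> cuts off the last of \<open>Suc k\<close> equal
    pieces of the segment from \<open>x\<close> to \<open>y\<close>.\<close>
  define t where "t = real k / real (Suc k)"
  have t: "0 \<le> t" "t \<le> 1" by (simp_all add: t_def)
  have t1: "1 - t = 1 / real (Suc k)" by (simp add: t_def field_simps)
  define z where "z = (1 - t) * x + t * y"
  have z: "z \<in> I11"
    using convexD[OF convex_real_interval(5)[of "-1" 1] \<open>x \<in> I11\<close> Suc.prems(1), of "1 - t" t] t
    by (simp add: z_def)
  have "x - z = (x - y) * t" by (simp add: z_def algebra_simps)
  then have "\<bar>x - z\<bar> = \<bar>x - y\<bar> * t" using t by (simp add: abs_mult)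
  also have "\<dots> \<le> (real (Suc k) * \<delta>) * t"
    by (intro mult_right_mono Suc.prems t)
  finally have 1: "\<bar>x - z\<bar> \<le> real k * \<delta>" by (simp add: t_def mult.commute del: of_nat_Suc)
  have "z - y = (x - y) * (1 - t)" by (simp add: z_def algebra_simps)
  then have "\<bar>z - y\<bar> = \<bar>x - y\<bar> * (1 - t)" using t by (simp add: abs_mult)
  also have "\<dots> \<le> (real (Suc k) * \<delta>) * (1 - t)"
    using t by (intro mult_right_mono Suc.prems) simp
  finally have 2: "\<bar>z - y\<bar> \<le> \<delta>" by (simp add: t1 del: of_nat_Suc)
  have "\<bar>g x - g z\<bar> \<le> real k * w" by (rule Suc.IH[OF z 1])
  moreover have "\<bar>g z - g y\<bar> \<le> w" by (rule w[OF z Suc.prems(1) 2])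
  ultimately show ?case by (simp add: algebra_simps)
qed simp

text \<open>A quadratic majorant, so that a positive kernel needs to be controlled only through its
  second moment.\<close>

lemma modulus_quadratic:
  fixes g :: "real \<Rightarrow> real"
  assumes d: "\<delta> > 0" and w: "\<And>x y. x \<in> I11 \<Longrightarrow> y \<in> I11 \<Longrightarrow> \<bar>x - y\<bar> \<le> \<delta> \<Longrightarrow> \<bar>g x - g y\<bar> \<le> w"
    and xy: "x \<in> I11" "y \<in> I11"
  shows "\<bar>g x - g y\<bar> \<le> w * (2 + (x - y)\<^sup>2 / \<delta>\<^sup>2)"
proof -
  define t where "t = \<bar>x - y\<bar> / \<delta>"
  have t: "t \<ge> 0" using d by (simp add: t_def)
  have w0: "0 \<le> w" using w[of 0 0] d by simp
  define k where "k = nat \<lceil>t\<rceil>"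
  have k: "t \<le> real k" "real k \<le> t + 1" using t by (simp_all add: k_def)
  have "\<bar>x - y\<bar> \<le> real k * \<delta>" using k(1) d by (simp add: t_def field_simps)
  from modulus_steps[OF d _ xy this] w have "\<bar>g x - g y\<bar> \<le> real k * w" by blast
  also have "\<dots> \<le> (t + 1) * w" by (intro mult_right_mono k w0)
  also have "t + 1 \<le> 2 + t\<^sup>2"
  proof -
    have "0 \<le> (t - 1/2)\<^sup>2" by simp
    then show ?thesis by (simp add: power2_eq_square algebra_simps)
  qed
  then have "(t + 1) * w \<le> (2 + t\<^sup>2) * w" by (intro mult_right_mono w0)
  also have "t\<^sup>2 = (x - y)\<^sup>2 / \<delta>\<^sup>2" by (simp add: t_def power_divide)
  finally show ?thesis by (simp add: mult.commute)
qed

section \<open>Jackson estimates\<close>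

text \<open>The Fejer-Korovkin weights \<open>a\<^sub>k = sin ((k + 1) \<pi> / (d + 2))\<close> form the top eigenvector of the
  path graph, which makes \<open>A\<^sub>1 / A\<^sub>0 = cos (\<pi> / (d + 2))\<close> as close to \<open>1\<close> as possible.\<close>
lemma fejer_korovkin_autocorr:
  fixes d :: nat
  defines "a \<equiv> \<lambda>k. sin (real (Suc k) * (pi / real (d + 2)))" and "c \<equiv> cos (pi / real (d + 2))"
  shows "autocorr a (Suc d) 0 > 0"
    and "autocorr a (Suc d) 1 = c * autocorr a (Suc d) 0"
    and "autocorr a (Suc d) 2 \<ge> (2 * c\<^sup>2 - 1) * autocorr a (Suc d) 0"
proof -
  define t where "t = pi / real (d + 2)"
  have a: "a k = sin (real (Suc k) * t)" for k by (simp add: a_def t_def)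
  have dt: "real (d + 2) * t = pi" by (simp add: t_def)
  have tpos: "t > 0" by (simp add: t_def)
  have rec: "a k + a (k + 2) = 2 * c * a (k + 1)" for k
  proof -
    have "sin (real (k + 2) * t - t) + sin (real (k + 2) * t + t) = 2 * cos t * sin (real (k + 2) * t)"
      by (simp add: sin_add sin_diff)
    moreover have "real (k + 2) * t - t = real (Suc k) * t" "real (k + 2) * t + t = real (Suc (k + 2)) * t"
      by (simp_all add: algebra_simps)
    ultimately show ?thesis by (simp add: a c_def t_def)
  qed
  have rec0: "2 * c * a 0 = a 1"
    using sin_double[of t] by (simp add: a c_def t_def)
  have a_pos: "a k > 0" if "k \<le> d" for k
  proof -
    have "real (Suc k) * t < real (d + 2) * t" using that tpos by (intro mult_strict_right_mono) auto
    then show ?thesis unfolding a dt using tpos by (intro sin_gt_zero) auto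
  qed
  \<comment> \<open>The sine vanishes one place past the last weight and is not positive two places
    past it; these boundary values close the recurrence.\<close>
  have a_d1: "a (d + 1) = 0" using dt by (simp add: a)
  have a_d2: "a (d + 2) \<le> 0"
  proof -
    have "real (Suc (d + 2)) * t = pi + t" using dt by (simp add: algebra_simps)
    then have "a (d + 2) = - sin t" by (simp add: a)
    moreover have "0 \<le> sin t" using tpos by (intro sin_ge_zero) (simp_all add: t_def field_simps)
    ultimately show ?thesis by simp
  qed
  have A0: "autocorr a (Suc d) 0 = (\<Sum>k<Suc d. a k * a k)"
    by (simp add: autocorr_def lessThan_def)
  have A1: "autocorr a (Suc d) 1 = (\<Sum>k<d. a k * a (k + 1))"
    by (simp add: autocorr_def lessThan_def)
  show "autocorr a (Suc d) 0 > 0"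
    unfolding A0 by (intro sum_pos) (auto intro!: mult_pos_pos a_pos)
  have A1': "autocorr a (Suc d) 1 = (\<Sum>k<Suc d. a k * a (k + 1))"
    unfolding A1 sum.lessThan_Suc using a_d1 by simp
  \<comment> \<open>Pairing the weights with their three-term recurrence counts each product of
    neighbours twice, so \<open>2 * c * A0 = 2 * A1\<close>.\<close>
  have "2 * c * autocorr a (Suc d) 0 = a 0 * (2 * c * a 0) + (\<Sum>k<d. a (k + 1) * (2 * c * a (k + 1)))"
    unfolding A0 sum.lessThan_Suc_shift by (simp add: sum_distrib_left algebra_simps)
  also have "\<dots> = a 0 * a 1 + (\<Sum>k<d. a (k + 1) * (a k + a (k + 2)))"
    by (simp only: rec0 rec)
  also have "\<dots> = autocorr a (Suc d) 1 + (a 0 * a 1 + (\<Sum>k<d. a (k + 1) * a (k + 2)))"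
    unfolding A1 by (simp add: algebra_simps sum.distrib)
  also have "a 0 * a 1 + (\<Sum>k<d. a (k + 1) * a (k + 2)) = autocorr a (Suc d) 1"
    unfolding A1' sum.lessThan_Suc_shift by simp
  finally show A1c: "autocorr a (Suc d) 1 = c * autocorr a (Suc d) 0" by simp
  have "(2 * c\<^sup>2 - 1) * autocorr a (Suc d) 0 = 2 * c * autocorr a (Suc d) 1 - autocorr a (Suc d) 0"
    unfolding A1c by (simp add: power2_eq_square algebra_simps)
  also have "\<dots> = (\<Sum>k<Suc d. a k * (2 * c * a (k + 1) - a k))"
    unfolding A0 A1' by (simp only: sum_distrib_left sum_subtractf[symmetric] algebra_simps)
  also have "\<dots> = (\<Sum>k<Suc d. a k * a (k + 2))"
    by (simp only: rec[symmetric] add_diff_cancel_left')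
  \<comment> \<open>The surplus indices have \<open>k + 2\<close> equal to \<open>d + 1\<close> or
    \<open>d + 2\<close>; their terms are zero or nonpositive, hence only an inequality.\<close>
  also have "\<dots> = (\<Sum>k\<in>{k. k + 2 < Suc d}. a k * a (k + 2)) + (\<Sum>k\<in>{..<Suc d} - {k. k + 2 < Suc d}. a k * a (k + 2))"
    by (rule sum.subset_diff[of "{k. k + 2 < Suc d}", THEN trans[OF _ add.commute]]) auto
  also have "(\<Sum>k\<in>{..<Suc d} - {k. k + 2 < Suc d}. a k * a (k + 2)) \<le> 0"
  proof (rule sum_nonpos)
    fix k assume k: "k \<in> {..<Suc d} - {k. k + 2 < Suc d}"
    then have "k + 2 = d + 1 \<or> k + 2 = d + 2" by auto
    then have "a (k + 2) \<le> 0" by (elim disjE; simp only: a_d1 a_d2 order_refl)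
    moreover have "a k > 0" using k by (intro a_pos) auto
    ultimately show "a k * a (k + 2) \<le> 0" by (simp add: mult_nonneg_nonpos)
  qed
  finally show "autocorr a (Suc d) 2 \<ge> (2 * c\<^sup>2 - 1) * autocorr a (Suc d) 0"
    by (simp add: autocorr_def)
qed

text \<open>Evaluate the operator at \<open>x = 1\<close>, where \<open>T_i = 1\<close>, and use
  \<open>T_i <= 1\<close> with nonnegative weights.\<close>

lemma autocorr_le_autocorr_0:
  assumes "0 < N" shows "autocorr a N i \<le> autocorr a N 0"
proof -
  define m where "m = N + i"
  have "autocorr a N i = (\<Sum>q<m. cheb_T i (cos (grid_angle m q)) * kernel_weight a N m q 1)"
    using kernel_weight_cheb_T[of N i m a 1] assms by (simp add: m_def cheb_T_def)
  also have "\<dots> \<le> (\<Sum>q<m. 1 * kernel_weight a N m q 1)"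
    using abs_cheb_T_le_1 by (intro sum_mono mult_right_mono kernel_weight_nonneg) (simp add: abs_le_iff)
  also have "\<dots> = autocorr a N 0" using assms by (simp add: sum_kernel_weight m_def)
  finally show ?thesis .
qed

text \<open>With \<open>y = x^2\<close> the left side is the second moment of the kernel. The sign
  of \<open>2 * y - 1\<close> decides whether the upper or the lower bound on \<open>A2\<close>
  applies.\<close>

lemma second_moment_bound:
  fixes y c A0 A2 :: real
  assumes "0 \<le> y" "y \<le> 1" "0 \<le> c" "c \<le> 1" "0 \<le> A0" "A2 \<le> A0" "(2 * c\<^sup>2 - 1) * A0 \<le> A2"
  shows "y * A0 - 2 * y * (c * A0) + (A0 + A2 * (2 * y - 1)) / 2 \<le> 2 * (1 - c) * A0"
proof (cases "1 \<le> 2 * y")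
  case True
  have "A2 * (2 * y - 1) \<le> A0 * (2 * y - 1)" using assms True by (intro mult_right_mono) auto
  then have "y * A0 - 2 * y * (c * A0) + (A0 + A2 * (2 * y - 1)) / 2 \<le> y * (2 * (1 - c) * A0)"
    by (simp add: algebra_simps)
  also have "\<dots> \<le> 2 * (1 - c) * A0"
    using assms by (intro mult_left_le_one_le mult_nonneg_nonneg) auto
  finally show ?thesis .
next
  case False
  have "A2 * (2 * y - 1) \<le> ((2 * c\<^sup>2 - 1) * A0) * (2 * y - 1)"
    using assms False by (intro mult_right_mono_neg) auto
  then have "y * A0 - 2 * y * (c * A0) + (A0 + A2 * (2 * y - 1)) / 2
      \<le> y * A0 - 2 * y * (c * A0) + (A0 + ((2 * c\<^sup>2 - 1) * A0) * (2 * y - 1)) / 2" by simp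
  also have "\<dots> = 2 * (1 - c) * A0 - (1 - c)\<^sup>2 * A0 - 2 * (y * (c * ((1 - c) * A0)))"
    by (simp add: power2_eq_square field_simps)
  also have "\<dots> \<le> 2 * (1 - c) * A0"
  proof -
    have "0 \<le> (1 - c)\<^sup>2 * A0" "0 \<le> y * (c * ((1 - c) * A0))"
      using assms by (intro mult_nonneg_nonneg; simp)+
    then show ?thesis by linarith
  qed
  finally show ?thesis .
qed

text \<open>The kernel operator divided by \<open>A 0\<close> is positive and fixes constants, so
  the error is at most a weighted average of \<open>|g x - g (X q)|\<close>. The 2 comes from the
  quadratic majorant, the 16 from the second moment.\<close>

lemma jackson_continuous:
  fixes g :: "real \<Rightarrow> real"
  assumes d: "\<delta> > 0" and w: "\<And>x y. x \<in> I11 \<Longrightarrow> y \<in> I11 \<Longrightarrow> \<bar>x - y\<bar> \<le> \<delta> \<Longrightarrow> \<bar>g x - g y\<bar> \<le> w"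
  obtains Q where "Q \<in> polys d"
    "\<And>x. x \<in> I11 \<Longrightarrow> \<bar>g x - Q x\<bar> \<le> w * (2 + 16 / (\<delta> * real (Suc d))\<^sup>2)"
proof -
  define a where "a = (\<lambda>k. sin (real (Suc k) * (pi / real (d + 2))))"
  define c where "c = cos (pi / real (d + 2))"
  \<comment> \<open>Two extra sample points make the operator exact on \<open>T_0\<close>,
    \<open>T_1\<close>, \<open>T_2\<close>, all that the second moment involves.\<close>
  define N m where "N = Suc d" and "m = Suc d + 2"
  define A where "A = autocorr a N"
  have fk: "A 0 > 0" "A 1 = c * A 0" "(2 * c\<^sup>2 - 1) * A 0 \<le> A 2"
    using fejer_korovkin_autocorr[of d] by (simp_all only: A_def N_def a_def c_def)
  define X where "X = (\<lambda>q. cos (grid_angle m q))"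
  define k where "k = kernel_weight a N m"
  have X: "X q \<in> I11" for q by (simp add: X_def)
  have w0: "0 \<le> w" using w[of 0 0] d by simp
  have kT: "(\<Sum>q<m. cheb_T i (X q) * k q x) = A i * cheb_T i x" if "i \<le> 2" for i x
    unfolding X_def k_def A_def using that by (intro kernel_weight_cheb_T) (simp_all add: N_def m_def)
  have k0: "(\<Sum>q<m. k q x) = A 0" for x using kT[of 0] by simp
  have c01: "0 \<le> c" "c \<le> 1"
    unfolding c_def by (rule cos_ge_zero) (simp_all add: field_simps order_trans[of _ 0])
  have moment: "(\<Sum>q<m. (x - X q)\<^sup>2 * k q x) \<le> 2 * (1 - c) * A 0" if x: "x \<in> I11" for x
  proof -
    have T2: "cheb_T 2 z = 2 * z\<^sup>2 - 1" if "z \<in> I11" for z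
      using cheb_T_Suc_Suc[OF that, of 0] cheb_T_1[OF that] by (simp add: numeral_2_eq_2)
    have T1: "cheb_T 1 z = z" if "z \<in> I11" for z using cheb_T_1[OF that] by simp
    have "(x - X q)\<^sup>2 * k q x
        = x\<^sup>2 * k q x - 2 * x * (cheb_T 1 (X q) * k q x) + (k q x + cheb_T 2 (X q) * k q x) / 2" for q
      unfolding T1[OF X] T2[OF X] by (simp add: power2_eq_square field_simps)
    then have "(\<Sum>q<m. (x - X q)\<^sup>2 * k q x)
        = x\<^sup>2 * A 0 - 2 * x * (A 1 * cheb_T 1 x) + (A 0 + A 2 * cheb_T 2 x) / 2"
      by (simp only: sum.distrib sum_subtractf sum_distrib_left[symmetric] sum_divide_distrib[symmetric]
          k0 kT[OF one_le_numeral] kT[OF order_refl])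
    also have "\<dots> = x\<^sup>2 * A 0 - 2 * x\<^sup>2 * (c * A 0) + (A 0 + A 2 * (2 * x\<^sup>2 - 1)) / 2"
      unfolding T1[OF x] T2[OF x] fk(2) by (simp add: power2_eq_square)
    also have "\<dots> \<le> 2 * (1 - c) * A 0"
    proof (rule second_moment_bound)
      show "x\<^sup>2 \<le> 1" using x by (simp add: abs_square_le_1 abs_le_iff)
      show "A 2 \<le> A 0" unfolding A_def by (rule autocorr_le_autocorr_0) (simp add: N_def)
    qed (use c01 fk in auto)
    finally show ?thesis .
  qed
  \<comment> \<open>From \<open>1 - cos s = 2 sin^2 (s/2) <= s^2 / 2\<close> and
    \<open>pi < 4\<close>.\<close>
  have c_bound: "2 * (1 - c) \<le> 16 / (real (Suc d))\<^sup>2"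
  proof -
    define s t where "s = pi / real (d + 2)" and "t = s / 2"
    have "2 * t = s" by (simp add: t_def)
    then have "1 - c = 2 * (sin t)\<^sup>2" using cos_double_sin[of t] by (simp add: c_def s_def)
    also have "(sin t)\<^sup>2 \<le> t\<^sup>2" using abs_sin_x_le_abs_x[of t] by (simp only: abs_le_square_iff)
    finally have "2 * (1 - c) \<le> 4 * t\<^sup>2" by simp
    also have "\<dots> = (pi / real (d + 2))\<^sup>2" unfolding s_def[symmetric] by (simp add: t_def power2_eq_square)
    also have "\<dots> \<le> (4 / real (Suc d))\<^sup>2"
      using pi_less_4 by (intro power_mono frac_le) auto
    finally show ?thesis by (simp add: power_divide)
  qed
  define Q where "Q = (\<lambda>x. \<Sum>q<m. (g (X q) / A 0) * k q x)"
  show thesis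
  proof (rule that)
    show "Q \<in> polys d"
      unfolding Q_def k_def by (intro polys_sum polys_cmult polys_kernel_weight) (simp add: N_def)
    fix x assume x: "x \<in> I11"
    have "A 0 * Q x = (\<Sum>q<m. g (X q) * k q x)"
      using fk(1) by (simp add: Q_def sum_distrib_left)
    moreover have "A 0 * g x = (\<Sum>q<m. g x * k q x)"
      by (simp add: k0[of x, symmetric] sum_distrib_left[symmetric] mult.commute)
    ultimately have "A 0 * (g x - Q x) = (\<Sum>q<m. (g x - g (X q)) * k q x)"
      by (simp add: right_diff_distrib left_diff_distrib sum_subtractf)
    also have "\<bar>\<dots>\<bar> \<le> (\<Sum>q<m. (w * (2 + (x - X q)\<^sup>2 / \<delta>\<^sup>2)) * k q x)"
    proof (rule order_trans[OF sum_abs], rule sum_mono)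
      fix q
      have k: "0 \<le> k q x" by (simp add: k_def kernel_weight_nonneg)
      have "\<bar>g x - g (X q)\<bar> \<le> w * (2 + (x - X q)\<^sup>2 / \<delta>\<^sup>2)"
        using modulus_quadratic[OF d _ x X] w by blast
      from mult_right_mono[OF this k] k
      show "\<bar>(g x - g (X q)) * k q x\<bar> \<le> (w * (2 + (x - X q)\<^sup>2 / \<delta>\<^sup>2)) * k q x"
        by (simp add: abs_mult)
    qed
    also have "\<dots> = w * (2 * A 0 + (\<Sum>q<m. (x - X q)\<^sup>2 * k q x) / \<delta>\<^sup>2)"
      by (simp add: k0[of x, symmetric] distrib_left distrib_right sum.distrib sum_distrib_left sum_divide_distrib mult.assoc)
    also have "\<dots> \<le> w * (2 * A 0 + (16 / (real (Suc d))\<^sup>2 * A 0) / \<delta>\<^sup>2)"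
    proof -
      have "(\<Sum>q<m. (x - X q)\<^sup>2 * k q x) \<le> 16 / (real (Suc d))\<^sup>2 * A 0"
        using moment[OF x] mult_right_mono[OF c_bound, of "A 0"] fk(1) by linarith
      then show ?thesis by (intro mult_left_mono add_left_mono divide_right_mono w0) auto
    qed
    also have "\<dots> = A 0 * (w * (2 + 16 / (\<delta> * real (Suc d))\<^sup>2))"
      by (simp add: power_mult_distrib algebra_simps del: of_nat_Suc)
    finally show "\<bar>g x - Q x\<bar> \<le> w * (2 + 16 / (\<delta> * real (Suc d))\<^sup>2)"
      using fk(1) by (simp add: abs_mult)
  qed
qed

text \<open>After subtracting an antiderivative of \<open>q\<close>, the function \<open>h\<close>
  becomes Lipschitz with constant \<open>e\<close>, to which the continuous case applies.\<close>

lemma jackson_antiderivative: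
  fixes h k q :: "real \<Rightarrow> real"
  assumes h: "\<And>x. x \<in> I11 \<Longrightarrow> (h has_real_derivative k x) (at x within I11)"
    and q: "q \<in> polys d" and e: "\<And>x. x \<in> I11 \<Longrightarrow> \<bar>k x - q x\<bar> \<le> e"
  obtains Q where "Q \<in> polys (Suc d)" "\<And>x. x \<in> I11 \<Longrightarrow> \<bar>h x - Q x\<bar> \<le> 18 * e / real (Suc d)"
proof -
  obtain R where R: "R \<in> polys (Suc d)" "\<And>x. x \<in> I11 \<Longrightarrow> (R has_real_derivative q x) (at x within I11)"
    by (rule polys_antiderivative[OF q]) blast
  \<comment> \<open>This step makes \<open>\<delta> * (d + 2) = 1\<close> for degree
    \<open>d + 1\<close>, so the factor is \<open>2 + 16 = 18\<close>.\<close>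
  define \<delta> where "\<delta> = 1 / real (Suc (Suc d))"
  have d: "\<delta> > 0" by (simp add: \<delta>_def)
  have e0: "0 \<le> e" using e[of 0] by simp
  have "\<bar>(h x - R x) - (h y - R y)\<bar> \<le> e * \<delta>" if "x \<in> I11" "y \<in> I11" "\<bar>x - y\<bar> \<le> \<delta>" for x y
  proof -
    have "norm ((h x - R x) - (h y - R y)) \<le> e * norm (x - y)"
    proof (rule field_differentiable_bound[of I11])
      fix z assume z: "z \<in> I11"
      show "((\<lambda>z. h z - R z) has_field_derivative (k z - q z)) (at z within I11)"
        by (intro DERIV_diff h R z)
      show "norm (k z - q z) \<le> e" using e[OF z] by simp
    qed (use that in auto)
    also have "\<dots> \<le> e * \<delta>" using that e0 by (intro mult_left_mono) auto
    finally show ?thesis by simp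
  qed
  then obtain S where S: "S \<in> polys (Suc d)"
    "\<And>x. x \<in> I11 \<Longrightarrow> \<bar>(h x - R x) - S x\<bar> \<le> e * \<delta> * (2 + 16 / (\<delta> * real (Suc (Suc d)))\<^sup>2)"
    using jackson_continuous[OF d, of "\<lambda>x. h x - R x" "e * \<delta>" "Suc d"] by blast
  show thesis
  proof (rule that)
    show "(\<lambda>x. R x + S x) \<in> polys (Suc d)" by (intro polys_add R S)
    fix x assume x: "x \<in> I11"
    have "\<bar>h x - (R x + S x)\<bar> \<le> 18 * e * \<delta>"
      using S(2)[OF x] by (simp add: \<delta>_def algebra_simps del: of_nat_Suc)
    also have "\<dots> \<le> 18 * e / real (Suc d)"
      using e0 by (simp add: \<delta>_def frac_le)
    finally show "\<bar>h x - (R x + S x)\<bar> \<le> 18 * e / real (Suc d)" .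
  qed
qed

primrec has_nth_deriv :: "nat \<Rightarrow> (real \<Rightarrow> real) \<Rightarrow> (real \<Rightarrow> real) \<Rightarrow> bool" where
  "has_nth_deriv 0 f g \<longleftrightarrow> (\<forall>x\<in>I11. g x = f x)"
| "has_nth_deriv (Suc r) f g \<longleftrightarrow> (\<exists>h. has_nth_deriv r f h \<and>
     (\<forall>x\<in>I11. (h has_real_derivative g x) (at x within I11)))"

text \<open>Each integration costs one degree and gains a factor \<open>18 / (d + 1)\<close>; the
  induction therefore varies \<open>d\<close> and \<open>e\<close>.\<close>

lemma jackson_iterate:
  assumes "has_nth_deriv r f g" "q \<in> polys d" "\<And>x. x \<in> I11 \<Longrightarrow> \<bar>g x - q x\<bar> \<le> e"
  shows "\<exists>Q\<in>polys (r + d). \<forall>x\<in>I11. \<bar>f x - Q x\<bar> \<le> 18 ^ r * e / real (Suc d) ^ r"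
  using assms
proof (induction r arbitrary: g q d e)
  case 0
  then show ?case by (intro bexI[of _ q]) auto
next
  case (Suc r)
  then obtain h where h: "has_nth_deriv r f h"
    "\<And>x. x \<in> I11 \<Longrightarrow> (h has_real_derivative g x) (at x within I11)" by auto
  obtain q1 where q1: "q1 \<in> polys (Suc d)" "\<And>x. x \<in> I11 \<Longrightarrow> \<bar>h x - q1 x\<bar> \<le> 18 * e / real (Suc d)"
    by (rule jackson_antiderivative[OF h(2) Suc.prems(2,3)]) blast+
  obtain Q where Q: "Q \<in> polys (r + Suc d)"
    "\<And>x. x \<in> I11 \<Longrightarrow> \<bar>f x - Q x\<bar> \<le> 18 ^ r * (18 * e / real (Suc d)) / real (Suc (Suc d)) ^ r"
    using Suc.IH[OF h(1) q1] by blast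
  have e0: "0 \<le> e" using Suc.prems(3)[of 0] by simp
  have "18 ^ r * (18 * e / real (Suc d)) / real (Suc (Suc d)) ^ r
      \<le> 18 ^ r * (18 * e / real (Suc d)) / real (Suc d) ^ r"
    using e0 by (intro divide_left_mono power_mono mult_nonneg_nonneg divide_nonneg_nonneg mult_pos_pos zero_less_power) auto
  also have "\<dots> = 18 ^ Suc r * e / real (Suc d) ^ Suc r" by (simp add: field_simps)
  finally have "\<bar>f x - Q x\<bar> \<le> 18 ^ Suc r * e / real (Suc d) ^ Suc r" if "x \<in> I11" for x
    using Q(2)[OF that] by linarith
  then show ?case using Q(1) by (intro bexI[of _ Q]) auto
qed

lemma jackson:
  fixes f g :: "real \<Rightarrow> real" and N :: nat
  assumes fg: "has_nth_deriv r f g" and N: "N > 0" and b: "real N \<le> b * real (Suc d)"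
    and w: "\<And>x y. x \<in> I11 \<Longrightarrow> y \<in> I11 \<Longrightarrow> \<bar>x - y\<bar> \<le> 1 / real N \<Longrightarrow> \<bar>g x - g y\<bar> \<le> w"
  shows "\<exists>Q\<in>polys (r + d). \<forall>x\<in>I11. \<bar>f x - Q x\<bar> \<le> (18 * b) ^ r * (2 + 16 * b\<^sup>2) * (w / real N ^ r)"
proof -
  have w0: "0 \<le> w" using w[of 0 0] by simp
  have d: "1 / real N > 0" using N by simp
  have Nd: "real N / real (Suc d) \<le> b" using b by (simp add: field_simps)
  have b0: "0 \<le> b" by (rule order_trans[OF _ Nd]) simp
  obtain q where q: "q \<in> polys d"
    "\<And>x. x \<in> I11 \<Longrightarrow> \<bar>g x - q x\<bar> \<le> w * (2 + 16 / (1 / real N * real (Suc d))\<^sup>2)"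
    by (rule jackson_continuous[OF d w]) blast+
  have "16 / (1 / real N * real (Suc d))\<^sup>2 = 16 * (real N / real (Suc d))\<^sup>2"
    by (simp add: power_divide power_mult_distrib)
  also have "\<dots> \<le> 16 * b\<^sup>2" using Nd by (intro mult_left_mono power_mono) auto
  finally have 1: "w * (2 + 16 / (1 / real N * real (Suc d))\<^sup>2) \<le> w * (2 + 16 * b\<^sup>2)"
    using w0 by (intro mult_left_mono add_left_mono)
  obtain Q where Q: "Q \<in> polys (r + d)"
    "\<And>x. x \<in> I11 \<Longrightarrow> \<bar>f x - Q x\<bar> \<le> 18 ^ r * (w * (2 + 16 * b\<^sup>2)) / real (Suc d) ^ r"
    using jackson_iterate[OF fg q(1), of "w * (2 + 16 * b\<^sup>2)"] q(2) 1 by (meson order_trans)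
  have "18 ^ r * (w * (2 + 16 * b\<^sup>2)) / real (Suc d) ^ r
      = 18 ^ r * (2 + 16 * b\<^sup>2) * (w / real N ^ r) * (real N / real (Suc d)) ^ r"
    using N by (simp add: power_divide field_simps)
  also have "\<dots> \<le> 18 ^ r * (2 + 16 * b\<^sup>2) * (w / real N ^ r) * b ^ r"
    using Nd w0 by (intro mult_left_mono power_mono mult_nonneg_nonneg divide_nonneg_nonneg) auto
  also have "\<dots> = (18 * b) ^ r * (2 + 16 * b\<^sup>2) * (w / real N ^ r)"
    by (simp add: power_mult_distrib mult_ac)
  finally show ?thesis using Q by (meson order_trans)
qed

section \<open>Slices and moduli in two variables\<close>

lemma has_nth_deriv_slice_x:
  "has_partial_x r f g \<Longrightarrow> y \<in> I11 \<Longrightarrow> has_nth_deriv r (\<lambda>x. f (x, y)) (\<lambda>x. g (x, y))"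
proof (induction r arbitrary: g)
  case (Suc r)
  then obtain h where h: "has_partial_x r f h"
    "\<forall>x\<in>I11. \<forall>y\<in>I11. ((\<lambda>t. h (t, y)) has_real_derivative g (x, y)) (at x within I11)" by auto
  show ?case
    using Suc.IH[OF h(1) Suc.prems(2)] h(2) Suc.prems(2)
    by (simp only: has_nth_deriv.simps) (rule exI[of _ "\<lambda>x. h (x, y)"], simp)
qed simp

lemma has_nth_deriv_slice_y:
  "has_partial_y s f g \<Longrightarrow> x \<in> I11 \<Longrightarrow> has_nth_deriv s (\<lambda>y. f (x, y)) (\<lambda>y. g (x, y))"
proof (induction s arbitrary: g)
  case (Suc s)
  then obtain h where h: "has_partial_y s f h"
    "\<forall>x\<in>I11. \<forall>y\<in>I11. ((\<lambda>t. h (x, t)) has_real_derivative g (x, y)) (at y within I11)" by auto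
  show ?case
    using Suc.IH[OF h(1) Suc.prems(2)] h(2) Suc.prems(2)
    by (simp only: has_nth_deriv.simps) (rule exI[of _ "\<lambda>y. h (x, y)"], simp)
qed simp

lemma le_modulus:
  assumes f: "continuous_on square f"
    and "x1 \<in> I11" "x2 \<in> I11" "y1 \<in> I11" "y2 \<in> I11" "\<bar>x1 - x2\<bar> \<le> u" "\<bar>y1 - y2\<bar> \<le> v"
  shows "\<bar>f (x1, y1) - f (x2, y2)\<bar> \<le> modulus f u v"
  unfolding modulus_def
proof (rule cSup_upper)
  show "bdd_above {\<bar>f (x1, y1) - f (x2, y2)\<bar> | x1 y1 x2 y2.
     x1 \<in> I11 \<and> x2 \<in> I11 \<and> y1 \<in> I11 \<and> y2 \<in> I11 \<and> \<bar>x1 - x2\<bar> \<le> u \<and> \<bar>y1 - y2\<bar> \<le> v}"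
  proof (rule bdd_aboveI[of _ "2 * sup_norm f"])
    fix t assume "t \<in> {\<bar>f (x1, y1) - f (x2, y2)\<bar> | x1 y1 x2 y2.
       x1 \<in> I11 \<and> x2 \<in> I11 \<and> y1 \<in> I11 \<and> y2 \<in> I11 \<and> \<bar>x1 - x2\<bar> \<le> u \<and> \<bar>y1 - y2\<bar> \<le> v}"
    then obtain x1 y1 x2 y2 where t: "t = \<bar>f (x1, y1) - f (x2, y2)\<bar>"
      and z: "(x1, y1) \<in> square" "(x2, y2) \<in> square" by blast
    show "t \<le> 2 * sup_norm f"
      unfolding t using abs_le_sup_norm[OF f z(1)] abs_le_sup_norm[OF f z(2)] by linarith
  qed
qed (use assms in blast)

lemma modulus_nonneg:
  assumes "continuous_on square f" "0 \<le> u" "0 \<le> v" shows "0 \<le> modulus f u v"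
  using le_modulus[OF assms(1), of 0 0 0 0 u v] assms by simp

text \<open>Three regimes: large \<open>n\<close> gives gap 1/2; bounded \<open>n\<close> with large
  \<open>M\<close> gives gap \<open>1 / (2k)\<close>, as \<open>s < n\<close> are integers;
  otherwise both are bounded and the gap is at least \<open>1 / (n * M)\<close>.\<close>

lemma degree_gap:
  fixes r s :: nat
  obtains \<sigma>0 :: real where "\<sigma>0 > 0"
    "\<And>n M :: nat. 0 < n \<Longrightarrow> n < M \<Longrightarrow> real r / real M + real s / real n < 1 \<Longrightarrow>
       \<sigma>0 \<le> 1 - real r / real M - real s / real n"
proof -
  define k where "k = 2 * (r + s) + 1"
  \<comment> \<open>Lies below the bounds of all three regimes; \<open>r + 1\<close> keeps the
    denominator positive when \<open>r = 0\<close>.\<close>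
  define \<sigma>0 where "\<sigma>0 = 1 / (2 * real k * real k * real (r + 1))"
  have k1: "real k \<ge> 1" by (simp add: k_def)
  show thesis
  proof (rule that)
    show "\<sigma>0 > 0" by (simp add: \<sigma>0_def k_def)
    fix n M :: nat
    assume n: "0 < n" "n < M" and lt: "real r / real M + real s / real n < 1"
    have "1 * 1 * 1 \<le> real k * real k * real (r + 1)" using k1 by (intro mult_mono) auto
    then have s2: "\<sigma>0 \<le> 1 / 2" unfolding \<sigma>0_def by (simp add: field_simps)
    have "real k * 1 * 1 \<le> real k * real k * real (r + 1)" using k1 by (intro mult_mono) auto
    then have sk: "\<sigma>0 \<le> 1 / (2 * real k)"
      unfolding \<sigma>0_def using k1 by (intro divide_left_mono) auto
    show "\<sigma>0 \<le> 1 - real r / real M - real s / real n"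
    proof (cases "k \<le> n")
      case True
      have "real r / real M \<le> real r / real n" using n by (intro divide_left_mono) auto
      moreover have "real r / real n + real s / real n \<le> 1 / 2"
        using True n by (simp add: k_def field_simps)
      ultimately show ?thesis using s2 by linarith
    next
      case False
      show ?thesis
      proof (cases "2 * r * k \<le> M")
        case True
        have "real s / real n < 1"
          using lt by (meson add_increasing divide_nonneg_nonneg le_less_trans of_nat_0_le_iff order_refl)
        then have "s + 1 \<le> n" using n by simp
        then have "real s / real n \<le> 1 - 1 / real n"
          using n by (simp add: field_simps)
        moreover have "1 / real k \<le> 1 / real n"
          using False n by (intro divide_left_mono) auto
        moreover have "real r / real M \<le> 1 / (2 * real k)"
        proof -
          have "real (2 * r * k) \<le> real M" using True by (simp only: of_nat_le_iff)
          then show ?thesis using n k1 by (simp add: field_simps)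
        qed
        moreover have "1 / real k = 1 / (2 * real k) + 1 / (2 * real k)" by simp
        ultimately show ?thesis using sk by linarith
      next
        case M: False
        have "real (r * n + s * M) < real (n * M)"
          using lt n by (simp add: field_simps)
        then have "r * n + s * M + 1 \<le> n * M" by (simp only: of_nat_less_iff)
        then have "real (r * n + s * M + 1) \<le> real (n * M)" by (simp only: of_nat_le_iff)
        then have "1 / real (n * M) \<le> 1 - real r / real M - real s / real n"
          using n by (simp add: field_simps)
        moreover have "\<sigma>0 \<le> 1 / real (n * M)"
        proof -
          have "n * M \<le> k * (2 * r * k)" using False M by (intro mult_mono) simp_all
          then have "real (n * M) \<le> real (k * (2 * r * k))" by (simp only: of_nat_le_iff)
          then have "real n * real M \<le> real k * (2 * real r * real k)" by simp
          also have "\<dots> \<le> 2 * real k * real k * real (r + 1)" by (simp add: algebra_simps)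
          finally show ?thesis
            unfolding \<sigma>0_def using n by (intro divide_left_mono) (auto simp: k_def)
        qed
        ultimately show ?thesis by linarith
      qed
    qed
  qed
qed

text \<open>Each variable takes a fifth of the gap \<open>\<sigma>\<close>, used twice in
  \<open>2 * d\<close> and \<open>2 * e\<close>: the total \<open>4/5 * \<sigma>\<close> keeps the
  inequality strict.\<close>

lemma degree_choice:
  fixes r s :: nat
  obtains b :: real where "b \<ge> 0"
    "\<And>n M :: nat. 0 < n \<Longrightarrow> n < M \<Longrightarrow> real r / real M + real s / real n < 1 \<Longrightarrow>
       \<exists>d e. (r + 2 * d) * n + (s + 2 * e) * M < n * M
           \<and> real M \<le> b * real (Suc d) \<and> real n \<le> b * real (Suc e)"
proof -
  obtain \<sigma>0 :: real where s0: "\<sigma>0 > 0"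
    "\<And>n M :: nat. 0 < n \<Longrightarrow> n < M \<Longrightarrow> real r / real M + real s / real n < 1 \<Longrightarrow>
       \<sigma>0 \<le> 1 - real r / real M - real s / real n"
    by (rule degree_gap[of r s]) blast
  show thesis
  proof (rule that)
    show "5 / \<sigma>0 \<ge> 0" using s0 by simp
    fix n M :: nat
    assume n: "0 < n" "n < M" and lt: "real r / real M + real s / real n < 1"
    define \<sigma> where "\<sigma> = 1 - real r / real M - real s / real n"
    have s: "\<sigma>0 \<le> \<sigma>" unfolding \<sigma>_def by (rule s0(2)[OF n lt])
    define d e where "d = nat \<lfloor>real M * \<sigma> / 5\<rfloor>" and "e = nat \<lfloor>real n * \<sigma> / 5\<rfloor>"
    have spos: "\<sigma> > 0" using s s0(1) by linarith
    have "0 \<le> real M * \<sigma> / 5" "0 \<le> real n * \<sigma> / 5" using spos by simp_all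
    then have de: "real d \<le> real M * \<sigma> / 5" "real M * \<sigma> / 5 \<le> real (Suc d)"
      "real e \<le> real n * \<sigma> / 5" "real n * \<sigma> / 5 \<le> real (Suc e)"
      unfolding d_def e_def by (simp_all, linarith+)
    have big: "real N \<le> 5 / \<sigma>0 * real (Suc c)" if "real N * \<sigma> / 5 \<le> real (Suc c)" for N c
    proof -
      have "real N * \<sigma>0 \<le> real N * \<sigma>" using s by (intro mult_left_mono) auto
      also have "\<dots> \<le> 5 * real (Suc c)" using that by (simp add: field_simps)
      finally have "real N * \<sigma>0 \<le> 5 * real (Suc c)" .
      then show ?thesis using s0(1) by (simp add: field_simps)
    qed
    have "x + 2 * u + y + 2 * v < 1" if "x + y = 1 - \<sigma>" "u \<le> \<sigma> / 5" "v \<le> \<sigma> / 5" for x y u v :: real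
      using that spos by linarith
    moreover have "real r / real M + real s / real n = 1 - \<sigma>" by (simp add: \<sigma>_def)
    moreover have "real d / real M \<le> \<sigma> / 5" "real e / real n \<le> \<sigma> / 5"
      using de n by (simp_all add: field_simps)
    ultimately have "real r / real M + 2 * (real d / real M) + real s / real n + 2 * (real e / real n) < 1"
      by blast
    then have "real ((r + 2 * d) * n + (s + 2 * e) * M) < real (n * M)"
      using n by (simp add: field_simps)
    then have "(r + 2 * d) * n + (s + 2 * e) * M < n * M" by (simp only: of_nat_less_iff)
    then show "\<exists>d e. (r + 2 * d) * n + (s + 2 * e) * M < n * M
        \<and> real M \<le> 5 / \<sigma>0 * real (Suc d) \<and> real n \<le> 5 / \<sigma>0 * real (Suc e)"
      using big[OF de(2)] big[OF de(4)] by blast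
  qed
qed

text \<open>Reproducing degree \<open>r + d\<close> with kernels of degree \<open>r + 2 * d\<close>
  leaves the divisor \<open>d + 1\<close>, so the norm stays below \<open>2 * r + 3\<close> for
  every \<open>d\<close>. The operator is fixed before \<open>f\<close>, hence serves all slices at
  once.\<close>

lemma quasi_interpolation_jackson:
  fixes r d N :: nat and b :: real
  assumes N: "N > 0" and b: "real N \<le> b * real (Suc d)"
  obtains m :: nat and X :: "nat \<Rightarrow> real" and \<phi> :: "nat \<Rightarrow> real \<Rightarrow> real" where
    "\<And>q. X q \<in> I11" "\<And>q. \<phi> q \<in> polys (r + 2 * d)" "\<And>x. (\<Sum>q<m. \<bar>\<phi> q x\<bar>) \<le> 2 * real r + 3"
    "\<And>f g w x. has_nth_deriv r f g \<Longrightarrow>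
       (\<And>x y. x \<in> I11 \<Longrightarrow> y \<in> I11 \<Longrightarrow> \<bar>x - y\<bar> \<le> 1 / real N \<Longrightarrow> \<bar>g x - g y\<bar> \<le> w) \<Longrightarrow> x \<in> I11 \<Longrightarrow>
       \<bar>f x - (\<Sum>q<m. f (X q) * \<phi> q x)\<bar> \<le> (2 * real r + 4) * ((18 * b) ^ r * (2 + 16 * b\<^sup>2)) * (w / real N ^ r)"
proof -
  obtain m :: nat and X \<phi> where q: "\<And>q. X q \<in> I11" "\<And>q. \<phi> q \<in> polys (r + 2 * d)"
    "\<And>u x. u \<in> polys (r + d) \<Longrightarrow> x \<in> I11 \<Longrightarrow> (\<Sum>q<m. u (X q) * \<phi> q x) = u x"
    "\<And>x. (\<Sum>q<m. \<bar>\<phi> q x\<bar>) \<le> real (r + 2 * d + 1 + (r + d)) / real (r + 2 * d + 1 - (r + d))"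
    by (rule quasi_interpolation[of "r + d" "r + 2 * d"]) auto
  have "real (r + 2 * d + 1 + (r + d)) / real (r + 2 * d + 1 - (r + d)) \<le> 2 * real r + 3"
  proof -
    have "r + 2 * d + 1 - (r + d) = Suc d" by simp
    moreover have "real (r + 2 * d + 1 + (r + d)) \<le> (2 * real r + 3) * real (Suc d)"
      by (simp add: algebra_simps)
    ultimately show ?thesis by (simp add: divide_le_eq del: of_nat_Suc)
  qed
  then have K: "(\<Sum>q<m. \<bar>\<phi> q x\<bar>) \<le> 2 * real r + 3" for x using q(4) order_trans by blast
  show thesis
  proof (rule that[OF q(1,2) K])
    fix f g :: "real \<Rightarrow> real" and w x
    assume fg: "has_nth_deriv r f g" and x: "x \<in> I11"
      and w: "\<And>x y. x \<in> I11 \<Longrightarrow> y \<in> I11 \<Longrightarrow> \<bar>x - y\<bar> \<le> 1 / real N \<Longrightarrow> \<bar>g x - g y\<bar> \<le> w"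
    obtain Q where Q: "Q \<in> polys (r + d)"
      "\<And>x. x \<in> I11 \<Longrightarrow> \<bar>f x - Q x\<bar> \<le> (18 * b) ^ r * (2 + 16 * b\<^sup>2) * (w / real N ^ r)"
      using jackson[OF fg N b w] by blast
    have "\<bar>f x - (\<Sum>q<m. f (X q) * \<phi> q x)\<bar>
        \<le> (1 + (2 * real r + 3)) * ((18 * b) ^ r * (2 + 16 * b\<^sup>2) * (w / real N ^ r))"
      by (rule quasi_interpolation_error[OF q(3) q(1) K Q x])
    also have "1 + (2 * real r + 3) = 2 * real r + 4" by simp
    finally show "\<bar>f x - (\<Sum>q<m. f (X q) * \<phi> q x)\<bar>
        \<le> (2 * real r + 4) * ((18 * b) ^ r * (2 + 16 * b\<^sup>2)) * (w / real N ^ r)"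
      by (simp only: mult.assoc)
  qed
qed

text \<open>\<open>A\<close> bounds the error in x; \<open>B\<close> bounds the error in y, which
  passes through the x-operator and so picks up its norm bound \<open>2 * r + 3\<close>.\<close>

lemma (in lissajous_params) best_approx_jackson:
  fixes r s d e :: nat and b :: real
  assumes deg: "(r + 2 * d) * n + (s + 2 * e) * M < n * M"
    and b: "b \<ge> 0" "real M \<le> b * real (Suc d)" "real n \<le> b * real (Suc e)"
    and f: "continuous_on square f"
    and fx: "has_partial_x r f fx" "continuous_on square fx"
    and fy: "has_partial_y s f fy" "continuous_on square fy"
  defines "A \<equiv> (2 * real r + 4) * ((18 * b) ^ r * (2 + 16 * b\<^sup>2))"
    and "B \<equiv> (2 * real s + 4) * ((18 * b) ^ s * (2 + 16 * b\<^sup>2))"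
  shows "best_approx n p f \<le> (A + (2 * real r + 3) * B) *
    (modulus fx (1 / real M) 0 / real M ^ r + modulus fy 0 (1 / real n) / real n ^ s)"
proof -
  define wx where "wx = modulus fx (1 / real M) 0 / real M ^ r"
  define wy where "wy = modulus fy 0 (1 / real n) / real n ^ s"
  have w0: "0 \<le> wx" "0 \<le> wy"
    unfolding wx_def wy_def by (intro divide_nonneg_nonneg modulus_nonneg fx fy; simp)+
  have AB: "0 \<le> A" "0 \<le> B" using b(1) by (simp_all add: A_def B_def)
  obtain m :: nat and X \<phi> where X: "\<And>q. X q \<in> I11" "\<And>q. \<phi> q \<in> polys (r + 2 * d)"
    "\<And>x. (\<Sum>q<m. \<bar>\<phi> q x\<bar>) \<le> 2 * real r + 3"
    and Xe: "\<And>f g w x. has_nth_deriv r f g \<Longrightarrow>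
       (\<And>x y. x \<in> I11 \<Longrightarrow> y \<in> I11 \<Longrightarrow> \<bar>x - y\<bar> \<le> 1 / real M \<Longrightarrow> \<bar>g x - g y\<bar> \<le> w) \<Longrightarrow> x \<in> I11 \<Longrightarrow>
       \<bar>f x - (\<Sum>q<m. f (X q) * \<phi> q x)\<bar> \<le> A * (w / real M ^ r)"
    unfolding A_def by (rule quasi_interpolation_jackson[OF M_pos b(2), of r]) blast
  obtain m' :: nat and Y \<psi> where Y: "\<And>q. Y q \<in> I11" "\<And>q. \<psi> q \<in> polys (s + 2 * e)"
    and Ye: "\<And>f g w x. has_nth_deriv s f g \<Longrightarrow>
       (\<And>x y. x \<in> I11 \<Longrightarrow> y \<in> I11 \<Longrightarrow> \<bar>x - y\<bar> \<le> 1 / real n \<Longrightarrow> \<bar>g x - g y\<bar> \<le> w) \<Longrightarrow> x \<in> I11 \<Longrightarrow>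
       \<bar>f x - (\<Sum>q<m'. f (Y q) * \<psi> q x)\<bar> \<le> B * (w / real n ^ s)"
    unfolding B_def by (rule quasi_interpolation_jackson[OF n_pos b(3), of s]) blast
  obtain T where T: "\<And>q l. T q l \<in> Pi_L n p" "\<And>q l z. z \<in> square \<Longrightarrow> T q l z = \<phi> q (fst z) * \<psi> l (snd z)"
    using Pi_L_tensor[OF X(2) Y(2) deg] by metis
  define P where "P = (\<lambda>z. \<Sum>q<m. \<Sum>l<m'. f (X q, Y l) * T q l z)"
  have P: "P \<in> Pi_L n p" unfolding P_def by (intro Pi_L_sum Pi_L_cmult T)
  have "\<bar>f z - P z\<bar> \<le> (A + (2 * real r + 3) * B) * (wx + wy)" if z: "z \<in> square" for z
  proof -
    obtain x y where xy: "z = (x, y)" "x \<in> I11" "y \<in> I11" using z by auto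
    have ex: "\<bar>f (x, y) - (\<Sum>q<m. f (X q, y) * \<phi> q x)\<bar> \<le> A * wx"
      unfolding wx_def
      by (rule Xe[OF has_nth_deriv_slice_x[OF fx(1) xy(3)] _ xy(2)])
        (rule le_modulus[OF fx(2)]; use xy in simp)
    have ey: "\<bar>f (X q, y) - (\<Sum>l<m'. f (X q, Y l) * \<psi> l y)\<bar> \<le> B * wy" for q
      unfolding wy_def
      by (rule Ye[OF has_nth_deriv_slice_y[OF fy(1) X(1)] _ xy(3)])
        (rule le_modulus[OF fy(2)]; use X(1) in simp)
    have "P z = (\<Sum>q<m. (\<Sum>l<m'. f (X q, Y l) * \<psi> l y) * \<phi> q x)"
      unfolding P_def T(2)[OF z] sum_distrib_right by (simp add: xy(1) mult_ac)
    then have "f z - P z = (f (x, y) - (\<Sum>q<m. f (X q, y) * \<phi> q x))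
        + (\<Sum>q<m. (f (X q, y) - (\<Sum>l<m'. f (X q, Y l) * \<psi> l y)) * \<phi> q x)"
      by (simp add: xy(1) left_diff_distrib sum_subtractf)
    moreover have "\<bar>\<Sum>q<m. (f (X q, y) - (\<Sum>l<m'. f (X q, Y l) * \<psi> l y)) * \<phi> q x\<bar> \<le> (2 * real r + 3) * (B * wy)"
    proof -
      have "\<bar>\<Sum>q<m. (f (X q, y) - (\<Sum>l<m'. f (X q, Y l) * \<psi> l y)) * \<phi> q x\<bar> \<le> (\<Sum>q<m. B * wy * \<bar>\<phi> q x\<bar>)"
        by (rule order_trans[OF sum_abs], rule sum_mono) (simp only: abs_mult, intro mult_right_mono ey abs_ge_zero)
      also have "\<dots> = (\<Sum>q<m. \<bar>\<phi> q x\<bar>) * (B * wy)" by (simp add: sum_distrib_left sum_distrib_right mult_ac)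
      also have "\<dots> \<le> (2 * real r + 3) * (B * wy)" by (intro mult_right_mono X mult_nonneg_nonneg AB w0)
      finally show ?thesis .
    qed
    ultimately have "\<bar>f z - P z\<bar> \<le> A * wx + (2 * real r + 3) * (B * wy)" using ex by linarith
    also have "\<dots> \<le> (A + (2 * real r + 3) * B) * (wx + wy)"
    proof -
      have "0 \<le> A * wy" "0 \<le> (2 * real r + 3) * B * wx" using AB w0 by simp_all
      then show ?thesis by (simp add: algebra_simps)
    qed
    finally show ?thesis .
  qed
  from best_approx_le[OF f P this] show ?thesis unfolding wx_def wy_def .
qed

theorem corollary12:
  fixes C_Lam :: real
  assumes C_Lam: "\<forall>n p :: nat. n > 0 \<and> p > 0 \<and> coprime n (n + p) \<longrightarrow>
     lebesgue_const n p \<le> C_Lam * (ln (real (n + p)))\<^sup>2"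
  shows "(\<forall>(n :: nat) (p :: nat) (f :: real \<times> real \<Rightarrow> real).
            n > 0 \<and> p > 0 \<and> coprime n (n + p) \<and> continuous_on square f \<longrightarrow>
            sup_norm (\<lambda>z. f z - interp n p f z)
              \<le> (C_Lam * (ln (real (n + p)))\<^sup>2 + 1) * best_approx n p f)
       \<and> (\<forall>(r :: nat) (s :: nat). \<exists>C :: real.
            \<forall>(n :: nat) (p :: nat) (f :: real \<times> real \<Rightarrow> real) fx fy.
              n > 0 \<and> p > 0 \<and> coprime n (n + p) \<and>
              real r / real (n + p) + real s / real n < 1 \<and>
              continuous_on square f \<and>
              has_partial_x r f fx \<and> continuous_on square fx \<and>
              has_partial_y s f fy \<and> continuous_on square fy \<longrightarrow>
              sup_norm (\<lambda>z. f z - interp n p f z)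
                \<le> C * (ln (real (n + p)))\<^sup>2 *
                  (modulus fx (1 / real (n + p)) 0 / real (n + p) ^ r
                   + modulus fy 0 (1 / real n) / real n ^ s))"
proof -
  have near_best: "sup_norm (\<lambda>z. f z - interp n p f z)
      \<le> (C_Lam * (ln (real (n + p)))\<^sup>2 + 1) * best_approx n p f"
    if "n > 0" "p > 0" "coprime n (n + p)" "continuous_on square f" for n p f
  proof -
    interpret lissajous_params n p "n + p" using that by unfold_locales auto
    show ?thesis using C_Lam that by (intro interp_error_le) auto
  qed
  have "\<exists>C. \<forall>n p f fx fy.
              n > 0 \<and> p > 0 \<and> coprime n (n + p) \<and>
              real r / real (n + p) + real s / real n < 1 \<and>
              continuous_on square f \<and>
              has_partial_x r f fx \<and> continuous_on square fx \<and>
              has_partial_y s f fy \<and> continuous_on square fy \<longrightarrow>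
              sup_norm (\<lambda>z. f z - interp n p f z)
                \<le> C * (ln (real (n + p)))\<^sup>2 *
                  (modulus fx (1 / real (n + p)) 0 / real (n + p) ^ r
                   + modulus fy 0 (1 / real n) / real n ^ s)" for r s :: nat
  proof -
    obtain b :: real where b: "b \<ge> 0"
      "\<And>n M :: nat. 0 < n \<Longrightarrow> n < M \<Longrightarrow> real r / real M + real s / real n < 1 \<Longrightarrow>
         \<exists>d e. (r + 2 * d) * n + (s + 2 * e) * M < n * M
             \<and> real M \<le> b * real (Suc d) \<and> real n \<le> b * real (Suc e)"
      by (rule degree_choice[of r s]) blast
    define D where "D = (2 * real r + 4) * ((18 * b) ^ r * (2 + 16 * b\<^sup>2))
      + (2 * real r + 3) * ((2 * real s + 4) * ((18 * b) ^ s * (2 + 16 * b\<^sup>2)))"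
    \<comment> \<open>Since \<open>n + p >= 2\<close>, the summand 1 is at most
      \<open>(ln (n + p))^2 / (ln 2)^2\<close>.\<close>
    define C where "C = (C_Lam + 1 / (ln 2)\<^sup>2) * D"
    show ?thesis
    proof (intro exI[of _ C] allI impI, elim conjE)
      fix n p :: nat and f fx fy :: "real \<times> real \<Rightarrow> real"
      assume np: "n > 0" "p > 0" "coprime n (n + p)" and rs: "real r / real (n + p) + real s / real n < 1"
        and f: "continuous_on square f"
        and fx: "has_partial_x r f fx" "continuous_on square fx"
        and fy: "has_partial_y s f fy" "continuous_on square fy"
      interpret lissajous_params n p "n + p" using np by unfold_locales auto
      let ?w = "modulus fx (1 / real (n + p)) 0 / real (n + p) ^ r + modulus fy 0 (1 / real n) / real n ^ s"
      let ?L = "(ln (real (n + p)))\<^sup>2"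
      obtain d e where "(r + 2 * d) * n + (s + 2 * e) * (n + p) < n * (n + p)"
        "real (n + p) \<le> b * real (Suc d)" "real n \<le> b * real (Suc e)"
        using b(2)[OF np(1) _ rs] np(2) by auto
      from best_approx_jackson[OF this(1) b(1) this(2,3) f fx fy]
      have E: "best_approx n p f \<le> D * ?w" unfolding D_def .
      have E0: "0 \<le> D * ?w" using best_approx_nonneg[OF f] E by linarith
      have "(ln 2)\<^sup>2 \<le> ?L" using np by (intro power_mono) (auto simp: ln_le_cancel_iff)
      then have "C_Lam * ?L + 1 \<le> (C_Lam + 1 / (ln 2)\<^sup>2) * ?L"
        by (simp add: field_simps)
      \<comment> \<open>The sign of \<open>C_Lam\<close> is not given; nonnegativity is inherited
        from the Lebesgue constant below it.\<close>
      moreover have "0 \<le> C_Lam * ?L + 1"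
        using C_Lam np lebesgue_const_nonneg by (meson add_nonneg_nonneg order_trans zero_le_one)
      ultimately have "(C_Lam * ?L + 1) * best_approx n p f \<le> ((C_Lam + 1 / (ln 2)\<^sup>2) * ?L) * (D * ?w)"
        using E best_approx_nonneg[OF f] by (intro mult_mono) auto
      also have "\<dots> = C * ?L * ?w" by (simp only: C_def mult_ac)
      finally show "sup_norm (\<lambda>z. f z - interp n p f z) \<le> C * ?L * ?w"
        using near_best[OF np f] by linarith
    qed
  qed
  with near_best show ?thesis by blast
qed

end
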